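(* There are no trinomials $x^6+Ax+B$ with $A,B\in\mathbb{Q}$, $AB\neq0$, having reducibility type $(1,1,2,2)$ or $(2,2,2)$.
   Context: A monic polynomial in $\mathbb{Q}[x]$ has reducibility type $(n_1,\dots,n_k)$, $n_1\le\dots\le n_k$, if it factors as a product of $k$ irreducible polynomials in $\mathbb{Q}[x]$ (not necessarily distinct) of degrees $n_1,\dots,n_k$. *)

theory Defs
  imports "HOL-Computational_Algebra.Computational_Algebra"
begin

(* Factors occur with multiplicity. They need not be monic. *)
definition has_reducibility_type :: "rat poly \<Rightarrow> nat list \<Rightarrow> bool" where
  "has_reducibility_type f ns \<longleftrightarrow>
     lead_coeff f = 1 \<and> sorted ns \<and>
     (\<exists>gs. f = prod_list gs \<and> (\<forall>g\<in>set gs. irreducible g) \<and> map degree gs = ns)"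

end

theory Submission
  imports Defs
begin

text \<open>
  Three quadratic factors \<open>x^2 + a x + b\<close>, \<open>x^2 + c x + d\<close>, \<open>x^2 + e x + f\<close> satisfy
  \<open>a + c + e = 0\<close>, and eliminating \<open>b, d, f\<close> from the vanishing coefficients leaves a rational point on
  the genus 2 curve \<open>y^2 = (a^2 + a c + c^2)^3 - 3 (a c e)^2\<close>; the points with \<open>a c e = 0\<close> give
  \<open>A = 0\<close>. Take \<open>a, c, e\<close> to be coprime integers with \<open>e\<close> even. The right-hand side is the norm of
  \<open>- a c - e^2 th\<close>, where \<open>th^3 + 3 th + 1 = 0\<close>. The ring \<open>Z[th]\<close> is norm-Euclidean and its units are
  \<open>\<plusminus> th^n\<close>, so that this element is a square up to \<open>- th\<close>, and modulo 4 it is a square. Comparing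
  coordinates yields coprime integers \<open>s\<close> odd and \<open>r\<close> even for which both \<open>s^2 + alpha r^2\<close> and
  \<open>s^2 + beta r^2\<close> are squares in \<open>Z[th]\<close>, where \<open>alpha = 2 - th\<close> and \<open>beta = 1 - th^2\<close>.

  This is a point \<open>X = s^2 / r^2\<close> on the elliptic curve \<open>y^2 = X (X + alpha) (X + beta)\<close> over \<open>Q(th)\<close>.
  That curve has rank 1, but the point is special: \<open>r / s\<close> is divisible by 2, and its leading 2-adic digit,
  an element of the field with 8 elements, is 1 because \<open>r / s\<close> is rational. The point is twice another
  point, which can be chosen to have the same leading digit and 2-adic depth smaller by one. Congruences
  modulo 4, signs at the real place and residues at a prime above 5 leave two square classes for the half. One
  of them is the trivial class and reproduces the situation; the other one, \<open>1 + 4 th\<close>, is the class of a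
  point of infinite order and is excluded by a second descent. So the depth drops to 1, where the equation
  \<open>w^2 + w = 1 + th^2\<close> over the field with 8 elements has no solution.
\<close>

subsection \<open>The ring Z[th]\<close>

text \<open>\<open>ZT a b c\<close> stands for \<open>a + b th + c th^2\<close> with \<open>th^3 = - 3 th - 1\<close>.\<close>
datatype zt = ZT (c0: int) (c1: int) (c2: int)

lemma zt_eq_iff: "x = y \<longleftrightarrow> c0 x = c0 y \<and> c1 x = c1 y \<and> c2 x = c2 y"
  by (cases x; cases y) simp

instantiation zt :: comm_ring_1
begin

definition "0 = ZT 0 0 0"
definition "1 = ZT 1 0 0"
definition "x + y = ZT (c0 x + c0 y) (c1 x + c1 y) (c2 x + c2 y)"
definition "- x = ZT (- c0 x) (- c1 x) (- c2 x)"
definition "x - y = ZT (c0 x - c0 y) (c1 x - c1 y) (c2 x - c2 y)"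
definition "x * y = ZT
  (c0 x * c0 y - c1 x * c2 y - c2 x * c1 y)
  (c0 x * c1 y + c1 x * c0 y - 3 * (c1 x * c2 y + c2 x * c1 y) - c2 x * c2 y)
  (c0 x * c2 y + c1 x * c1 y + c2 x * c0 y - 3 * (c2 x * c2 y))"

instance
  by standard
    (auto simp: zt_eq_iff zero_zt_def one_zt_def plus_zt_def uminus_zt_def minus_zt_def
      times_zt_def algebra_simps)

end

lemma zt_coeffs [simp]:
  "c0 0 = 0" "c1 0 = 0" "c2 0 = 0" "c0 1 = 1" "c1 1 = 0" "c2 1 = 0"
  "c0 (x + y) = c0 x + c0 y" "c1 (x + y) = c1 x + c1 y" "c2 (x + y) = c2 x + c2 y"
  "c0 (- x) = - c0 x" "c1 (- x) = - c1 x" "c2 (- x) = - c2 x"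
  "c0 (x - y) = c0 x - c0 y" "c1 (x - y) = c1 x - c1 y" "c2 (x - y) = c2 x - c2 y"
  by (simp_all add: zero_zt_def one_zt_def plus_zt_def uminus_zt_def minus_zt_def)

lemma zt_coeffs_mult:
  "c0 (x * y) = c0 x * c0 y - c1 x * c2 y - c2 x * c1 y"
  "c1 (x * y) = c0 x * c1 y + c1 x * c0 y - 3 * (c1 x * c2 y + c2 x * c1 y) - c2 x * c2 y"
  "c2 (x * y) = c0 x * c2 y + c1 x * c1 y + c2 x * c0 y - 3 * (c2 x * c2 y)"
  by (simp_all add: times_zt_def)

lemma of_int_zt: "of_int n = ZT n 0 0"
proof (induction n rule: int_induct[of _ 0])
  case base
  then show ?case by (simp add: zt_eq_iff)
next
  case (step1 i)
  then show ?case by (simp add: zt_eq_iff)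
next
  case (step2 i)
  then show ?case by (simp add: zt_eq_iff)
qed

lemma c_of_int [simp]: "c0 (of_int n) = n" "c1 (of_int n) = 0" "c2 (of_int n) = 0"
  by (simp_all add: of_int_zt)

lemma c_numeral [simp]:
  "c0 (numeral k) = numeral k" "c1 (numeral k) = 0" "c2 (numeral k) = 0"
  using c_of_int[of "numeral k"] by simp_all

instance zt :: ring_char_0
proof
  show "inj (of_nat :: nat \<Rightarrow> zt)"
    by (rule injI) (metis c_of_int(1) of_int_of_nat_eq of_nat_eq_iff)
qed

definition nrm :: "zt \<Rightarrow> int" where
  "nrm x = c0 x ^ 3 - c1 x ^ 3 + c2 x ^ 3 - 6 * c0 x ^ 2 * c2 x + 3 * c0 x * c1 x ^ 2
     + 9 * c0 x * c2 x ^ 2 + 3 * c0 x * c1 x * c2 x - 3 * c1 x * c2 x ^ 2"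

lemma nrm_mult: "nrm (x * y) = nrm x * nrm y"
  unfolding nrm_def zt_coeffs_mult by algebra

text \<open>The product of the other two conjugates of \<open>x\<close>.\<close>

definition cof :: "zt \<Rightarrow> zt" where
  "cof x = ZT
     (c0 x ^ 2 - 6 * c0 x * c2 x + 9 * c2 x ^ 2 + c1 x * c2 x + 3 * c1 x ^ 2)
     (- (c2 x ^ 2) - c0 x * c1 x)
     (c1 x ^ 2 - c0 x * c2 x + 3 * c2 x ^ 2)"

lemma cof_mult: "x * cof x = of_int (nrm x)"
  unfolding zt_eq_iff zt_coeffs_mult c_of_int nrm_def cof_def zt.sel
  by (intro conjI; algebra)

text \<open>2 is inert: modulo 2 the minimal polynomial of \<open>th\<close> becomes the irreducible
  \<open>t^3 + t + 1\<close>.\<close>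

lemma nrm_even: "even (nrm x) \<longleftrightarrow> even (c0 x) \<and> even (c1 x) \<and> even (c2 x)"
  unfolding nrm_def by (auto simp: even_add)

text \<open>Infinite descent: by \<open>nrm_even\<close> a zero of the norm has even coordinates,
  and halving them gives a smaller zero.\<close>

lemma nrm_eq_0: "nrm x = 0 \<Longrightarrow> x = 0"
proof (induction "nat (\<bar>c0 x\<bar> + \<bar>c1 x\<bar> + \<bar>c2 x\<bar>)" arbitrary: x rule: less_induct)
  case less
  then have "even (nrm x)" by simp
  then have "even (c0 x) \<and> even (c1 x) \<and> even (c2 x)"
    unfolding nrm_even .
  then obtain a b c where abc: "c0 x = 2 * a" "c1 x = 2 * b" "c2 x = 2 * c" by (auto elim!: evenE)
  show "x = 0"
  proof (rule ccontr)
    assume nz: "x \<noteq> 0"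
    have "nrm x = 8 * nrm (ZT a b c)"
      unfolding nrm_def abc by (simp add: algebra_simps power_mult_distrib)
    then have "nrm (ZT a b c) = 0" using less.prems by simp
    moreover have "nat (\<bar>a\<bar> + \<bar>b\<bar> + \<bar>c\<bar>) < nat (\<bar>c0 x\<bar> + \<bar>c1 x\<bar> + \<bar>c2 x\<bar>)"
      using nz by (auto simp: zt_eq_iff abc)
    ultimately have "ZT a b c = 0" using less.hyps[of "ZT a b c"] by simp
    then show False using nz by (simp add: zt_eq_iff abc)
  qed
qed

lemma nrm_0_1 [simp]: "nrm 0 = 0" "nrm 1 = 1"
  by (simp_all add: nrm_def)

lemma nrm_eq_0_iff [simp]: "nrm x = 0 \<longleftrightarrow> x = 0"
  using nrm_eq_0 by auto

instance zt :: idom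
proof
  fix a b :: zt
  assume "a \<noteq> 0" "b \<noteq> 0"
  then have "nrm (a * b) \<noteq> 0" by (simp add: nrm_mult)
  then show "a * b \<noteq> 0" by auto
qed

subsection \<open>Norm-Euclidean division\<close>

lemma rt_exists: "\<exists>t::real. - 3222 / 10000 < t \<and> t < - 3221 / 10000 \<and> t ^ 3 + 3 * t + 1 = 0"
proof -
  let ?f = "\<lambda>t::real. t ^ 3 + 3 * t + 1"
  have "\<exists>t\<ge>- 3222 / 10000. t \<le> - 3221 / 10000 \<and> ?f t = 0"
    by (rule IVT) (auto simp: eval_nat_numeral)
  then obtain t where t: "- 3222 / 10000 \<le> t" "t \<le> - 3221 / 10000" "?f t = 0" by auto
  moreover have "t \<noteq> - 3222 / 10000" "t \<noteq> - 3221 / 10000"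
    using t(3) by (auto simp: eval_nat_numeral)
  ultimately show ?thesis by force
qed

definition rt :: real where
  "rt = (SOME t. - 3222 / 10000 < t \<and> t < - 3221 / 10000 \<and> t ^ 3 + 3 * t + 1 = 0)"

lemma rt_bounds: "- 3222 / 10000 < rt" "rt < - 3221 / 10000" and rt_root: "rt ^ 3 + 3 * rt + 1 = 0"
  using someI_ex[OF rt_exists] unfolding rt_def by auto

lemma rt_sq_bounds: "1037 / 10000 < rt ^ 2" "rt ^ 2 < 10382 / 100000"
proof -
  have "(3221 / 10000) ^ 2 < (- rt) ^ 2" "(- rt) ^ 2 < (3222 / 10000) ^ 2"
    using rt_bounds by (intro power_strict_mono; simp)+
  then show "1037 / 10000 < rt ^ 2" "rt ^ 2 < 10382 / 100000" by (simp_all add: power2_eq_square)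
qed

definition rl :: "zt \<Rightarrow> real" where
  "rl x = c0 x + c1 x * rt + c2 x * rt ^ 2"

lemma rl_simps [simp]:
  "rl (x + y) = rl x + rl y" "rl (x - y) = rl x - rl y" "rl (- x) = - rl x"
  "rl 0 = 0" "rl 1 = 1" "rl (of_int n) = n" "rl (numeral k) = numeral k"
  by (simp_all add: rl_def algebra_simps)

lemma rl_mult [simp]: "rl (x * y) = rl x * rl y"
  unfolding rl_def zt_coeffs_mult of_int_add of_int_diff of_int_mult of_int_numeral
  using rt_root by algebra

lemma rl_power [simp]: "rl (x ^ n) = rl x ^ n"
  by (induction n) simp_all

definition nf :: "real \<Rightarrow> real \<Rightarrow> real \<Rightarrow> real" where
  "nf x y z = x ^ 3 - y ^ 3 + z ^ 3 - 6 * x ^ 2 * z + 3 * x * y ^ 2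
     + 9 * x * z ^ 2 + 3 * x * y * z - 3 * y * z ^ 2"

text \<open>The norm is the real embedding times the squared absolute value of the complex one. The
  complex conjugates of \<open>th\<close> have sum \<open>- rt\<close> and product
  \<open>3 + rt^2\<close>, so the two squares are those of twice the real part and twice the
  imaginary part.\<close>

lemma nf_factor:
  "4 * nf x y z = (x + y * rt + z * rt ^ 2) *
     ((2 * x - rt * y - (6 + rt ^ 2) * z) ^ 2 + (12 + 3 * rt ^ 2) * (y - rt * z) ^ 2)"
  unfolding nf_def using rt_root by algebra

lemma nrm_nf: "real_of_int (nrm x) = nf (c0 x) (c1 x) (c2 x)"
  by (simp add: nrm_def nf_def)

lemma rl_eq_0_iff [simp]: "rl x = 0 \<longleftrightarrow> x = 0"
proof
  assume "rl x = 0"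
  then have "real_of_int (nrm x) = 0"
    using nf_factor[of "c0 x" "c1 x" "c2 x"] unfolding nrm_nf rl_def by simp
  then show "x = 0" by simp
qed simp

text \<open>
  The three linear forms are rational approximations of the real embedding and of the real part and the
  (normalised) imaginary part of the complex embedding; \<open>1 / 1000\<close> absorbs the approximation error.
\<close>
lemma nf_small:
  assumes "\<bar>y\<bar> \<le> 5" "\<bar>z\<bar> \<le> 5"
    and "\<bar>10000 * x - 3222 * y + 1038 * z\<bar> \<le> 10000 * l"
    and "\<bar>10000 * x + 1611 * y - 30519 * z\<bar> \<le> 10000 * r"
    and "\<bar>10000 * y + 3222 * z\<bar> \<le> 10000 * i"
    and small: "(l + 1 / 1000) * ((r + 1 / 1000) ^ 2 * 1000 + 3078 * (i + 1 / 1000) ^ 2) < 1000"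
  shows "\<bar>nf x y z\<bar> < 1"
proof -
  have err: "\<bar>a * e\<bar> \<le> 5 * d" if "\<bar>a\<bar> \<le> 5" "\<bar>e\<bar> \<le> d" for a e d :: real
    using mult_mono[OF that] by (simp add: abs_mult)
  have 1: "\<bar>y * (rt + 3222 / 10000)\<bar> \<le> 5 * (1 / 10000)" "\<bar>z * (rt + 3222 / 10000)\<bar> \<le> 5 * (1 / 10000)"
    "\<bar>z * (rt ^ 2 - 1038 / 10000)\<bar> \<le> 5 * (1 / 10000)"
    using rt_bounds rt_sq_bounds by (intro err assms; simp only: abs_le_iff; linarith)+
  have 2: "\<bar>x + y * rt + z * rt ^ 2\<bar> \<le> l + 1 / 1000"
    using assms(3) 1 unfolding abs_le_iff by (simp add: algebra_simps)
  have 3: "\<bar>2 * x - rt * y - (6 + rt ^ 2) * z\<bar> \<le> 2 * (r + 1 / 1000)"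
    using assms(4) 1 unfolding abs_le_iff by (simp add: algebra_simps)
  have 4: "\<bar>y - rt * z\<bar> \<le> i + 1 / 1000"
    using assms(5) 1 unfolding abs_le_iff by (simp add: algebra_simps)
  have "(2 * x - rt * y - (6 + rt ^ 2) * z) ^ 2 \<le> (2 * (r + 1 / 1000)) ^ 2"
    "(y - rt * z) ^ 2 \<le> (i + 1 / 1000) ^ 2"
    using power_mono[OF 3, of 2] power_mono[OF 4, of 2] by simp_all
  \<comment> \<open>\<open>12312 / 1000\<close> bounds \<open>12 + 3 * rt ^ 2\<close>; a quarter of
    it is the coefficient \<open>3078 / 1000\<close>.\<close>
  then have "(2 * x - rt * y - (6 + rt ^ 2) * z) ^ 2 + (12 + 3 * rt ^ 2) * (y - rt * z) ^ 2
      \<le> (2 * (r + 1 / 1000)) ^ 2 + (12312 / 1000) * (i + 1 / 1000) ^ 2"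
    using rt_sq_bounds by (intro add_mono mult_mono) auto
  also have "\<dots> = 4 / 1000 * ((r + 1 / 1000) ^ 2 * 1000 + 3078 * (i + 1 / 1000) ^ 2)"
    by (simp add: power2_eq_square algebra_simps)
  finally have 5: "(2 * x - rt * y - (6 + rt ^ 2) * z) ^ 2 + (12 + 3 * rt ^ 2) * (y - rt * z) ^ 2
      \<le> 4 / 1000 * ((r + 1 / 1000) ^ 2 * 1000 + 3078 * (i + 1 / 1000) ^ 2)" .
  have "\<bar>4 * nf x y z\<bar> \<le>
     (l + 1 / 1000) * (4 / 1000 * ((r + 1 / 1000) ^ 2 * 1000 + 3078 * (i + 1 / 1000) ^ 2))"
    unfolding nf_factor abs_mult using 2 5 rt_sq_bounds
    by (intro mult_mono) (auto simp: abs_of_nonneg)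
  also have "\<dots> < 4" using small by (simp add: field_simps)
  finally show ?thesis by simp
qed

text \<open>
  A certificate that every point of a box is within norm less than 1 of the lattice. The constructors \<open>SX\<close>,
  \<open>SY\<close>, \<open>SZ\<close> halve the box along a coordinate, and \<open>Leaf a b c\<close> names a lattice point that serves a whole
  box. Box coordinates are scaled by 256 and the linear forms by 10000, so that all checks are on integers.
\<close>
datatype cover = Leaf int int int | SX cover cover | SY cover cover | SZ cover cover

fun covers :: "cover \<Rightarrow> int \<Rightarrow> int \<Rightarrow> int \<Rightarrow> int \<Rightarrow> int \<Rightarrow> int \<Rightarrow> bool" where
  "covers (Leaf a b c) x0 x1 y0 y1 z0 z1 \<longleftrightarrow>
     (let X0 = x0 - 256 * a; X1 = x1 - 256 * a; Y0 = y0 - 256 * b; Y1 = y1 - 256 * b;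
          Z0 = z0 - 256 * c; Z1 = z1 - 256 * c;
          l = max (- (10000 * X0 - 3222 * Y1 + 1038 * Z0)) (10000 * X1 - 3222 * Y0 + 1038 * Z1) + 2560;
          r = max (- (10000 * X0 + 1611 * Y0 - 30519 * Z1)) (10000 * X1 + 1611 * Y1 - 30519 * Z0) + 2560;
          i = max (- (10000 * Y0 + 3222 * Z0)) (10000 * Y1 + 3222 * Z1) + 2560
      in - 1280 \<le> Y0 \<and> Y1 \<le> 1280 \<and> - 1280 \<le> Z0 \<and> Z1 \<le> 1280 \<and>
         l * (r * r * 1000 + 3078 * (i * i)) < 16777216000000000000000)"
| "covers (SX s t) x0 x1 y0 y1 z0 z1 \<longleftrightarrow>
     (let m = (x0 + x1) div 2 in covers s x0 m y0 y1 z0 z1 \<and> covers t m x1 y0 y1 z0 z1)"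
| "covers (SY s t) x0 x1 y0 y1 z0 z1 \<longleftrightarrow>
     (let m = (y0 + y1) div 2 in covers s x0 x1 y0 m z0 z1 \<and> covers t x0 x1 m y1 z0 z1)"
| "covers (SZ s t) x0 x1 y0 y1 z0 z1 \<longleftrightarrow>
     (let m = (z0 + z1) div 2 in covers s x0 x1 y0 y1 z0 m \<and> covers t x0 x1 y0 y1 m z1)"

lemma covers_sound:
  fixes x y z :: real
  assumes "covers T x0 x1 y0 y1 z0 z1"
    and "x0 \<le> 256 * x" "256 * x \<le> x1" "y0 \<le> 256 * y" "256 * y \<le> y1" "z0 \<le> 256 * z" "256 * z \<le> z1"
  shows "\<exists>(a::int) (b::int) (c::int). \<bar>nf (x - a) (y - b) (z - c)\<bar> < 1"
  using assms
proof (induction T arbitrary: x0 x1 y0 y1 z0 z1)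
  case (Leaf a b c)
  define X0 X1 Y0 Y1 Z0 Z1 where "X0 = x0 - 256 * a" and "X1 = x1 - 256 * a"
    and "Y0 = y0 - 256 * b" and "Y1 = y1 - 256 * b" and "Z0 = z0 - 256 * c" and "Z1 = z1 - 256 * c"
  note defs = this
  define l where "l = max (- (10000 * X0 - 3222 * Y1 + 1038 * Z0)) (10000 * X1 - 3222 * Y0 + 1038 * Z1)"
  define r where "r = max (- (10000 * X0 + 1611 * Y0 - 30519 * Z1)) (10000 * X1 + 1611 * Y1 - 30519 * Z0)"
  define i where "i = max (- (10000 * Y0 + 3222 * Z0)) (10000 * Y1 + 3222 * Z1)"
  define u v w where "u = x - a" and "v = y - b" and "w = z - c"
  note uvw = this
  have chk: "- 1280 \<le> Y0" "Y1 \<le> 1280" "- 1280 \<le> Z0" "Z1 \<le> 1280"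
    and lt: "(l + 2560) * ((r + 2560) * (r + 2560) * 1000 + 3078 * ((i + 2560) * (i + 2560)))
      < 16777216000000000000000"
    using Leaf.prems(1) unfolding l_def r_def i_def defs covers.simps Let_def by auto
  have box: "X0 \<le> 256 * u" "256 * u \<le> X1" "Y0 \<le> 256 * v" "256 * v \<le> Y1" "Z0 \<le> 256 * w" "256 * w \<le> Z1"
    using Leaf.prems(2-) unfolding uvw defs by simp_all
  have chk': "- 1280 \<le> real_of_int Y0" "real_of_int Y1 \<le> 1280" "- 1280 \<le> real_of_int Z0"
      "real_of_int Z1 \<le> 1280"
    using chk by linarith+
  have L: "- real_of_int l \<le> 10000 * X0 - 3222 * Y1 + 1038 * Z0"
    "10000 * X1 - 3222 * Y0 + 1038 * Z1 \<le> real_of_int l"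
    unfolding l_def by linarith+
  have R: "- real_of_int r \<le> 10000 * X0 + 1611 * Y0 - 30519 * Z1"
    "10000 * X1 + 1611 * Y1 - 30519 * Z0 \<le> real_of_int r"
    unfolding r_def by linarith+
  have I: "- real_of_int i \<le> 10000 * Y0 + 3222 * Z0" "10000 * Y1 + 3222 * Z1 \<le> real_of_int i"
    unfolding i_def by linarith+
  have "\<bar>nf u v w\<bar> < 1"
  \<comment> \<open>Dividing by \<open>2560000 = 256 * 10000\<close> undoes both scalings. The
    summand \<open>2560\<close> of the check becomes the \<open>1 / 1000\<close> of
    \<open>nf_small\<close>, and the bound of the check is \<open>1000 * 2560000^3\<close>.\<close>
  proof (rule nf_small[where l = "l / 2560000" and r = "r / 2560000" and i = "i / 2560000"])
    show "\<bar>v\<bar> \<le> 5" using box chk' by linarith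
    show "\<bar>w\<bar> \<le> 5" using box chk' by linarith
    show "\<bar>10000 * u - 3222 * v + 1038 * w\<bar> \<le> 10000 * (l / 2560000)"
      using box L unfolding abs_le_iff by (intro conjI; linarith)
    show "\<bar>10000 * u + 1611 * v - 30519 * w\<bar> \<le> 10000 * (r / 2560000)"
      using box R unfolding abs_le_iff by (intro conjI; linarith)
    show "\<bar>10000 * v + 3222 * w\<bar> \<le> 10000 * (i / 2560000)"
      using box I unfolding abs_le_iff by (intro conjI; linarith)
    have "real_of_int ((l + 2560) * ((r + 2560) * (r + 2560) * 1000 + 3078 * ((i + 2560) * (i + 2560))))
      < 16777216000000000000000"
      using lt by linarith
    then show "(l / 2560000 + 1 / 1000) * ((r / 2560000 + 1 / 1000) ^ 2 * 1000
        + 3078 * (i / 2560000 + 1 / 1000) ^ 2) < 1000"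
      by (simp add: power2_eq_square field_simps)
  qed
  then show ?case unfolding uvw by blast
next
  case (SX s t)
  then show ?case
    by (cases "256 * x \<le> real_of_int ((x0 + x1) div 2)") (auto simp: Let_def)
next
  case (SY s t)
  then show ?case
    by (cases "256 * y \<le> real_of_int ((y0 + y1) div 2)") (auto simp: Let_def)
next
  case (SZ s t)
  then show ?case
    by (cases "256 * z \<le> real_of_int ((z0 + z1) div 2)") (auto simp: Let_def)
qed

text \<open>The box is \<open>[0, 1] x [-1/2, 1/2] x [0, 1/2]\<close>. Translations and the symmetry
  \<open>nf_neg\<close> move every point into it.\<close>

lemma unit_cube_covered:
  "covers
    (SX (SZ (SX (Leaf 0 0 0) (Leaf 0 0 0)) (SY (SX (SY (SY (Leaf 0 (-1) 0) (Leaf (-1) 0 0))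
     (Leaf (-1) 0 0)) (SZ (SX (Leaf 0 0 0) (Leaf 0 0 0)) (Leaf (-1) 0 0))) (SY (SZ (Leaf 0 0
     0) (Leaf 2 0 1)) (SX (Leaf 0 0 0) (SX (Leaf 0 0 0) (SX (Leaf 0 (-1) 0) (SY (Leaf 0 0 0)
     (Leaf 1 2 0)))))))) (SX (SY (SZ (SX (Leaf 0 0 0) (Leaf 1 0 0)) (SZ (SX (Leaf 0 0 0)
     (Leaf 0 0 0)) (SY (SY (SX (Leaf (-4) 0 (-1)) (Leaf 1 0 0)) (SY (Leaf (-1) 0 0) (Leaf
     (-1) 0 0))) (Leaf (-1) 0 0)))) (SX (SY (SX (Leaf 0 0 0) (Leaf 0 0 0)) (SZ (Leaf 0 0 0)
     (SZ (Leaf 0 0 0) (SY (Leaf 2 0 1) (SX (Leaf 0 (-1) 1) (SY (Leaf 2 0 1) (Leaf (-4) 1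
     (-1)))))))) (SY (Leaf 1 1 0) (SZ (Leaf 1 1 0) (SY (Leaf 1 1 0) (Leaf 1 1 0)))))) (SZ
     (Leaf 1 0 0) (SY (Leaf 1 0 0) (SX (SY (SX (Leaf 1 1 1) (Leaf 1 0 0)) (Leaf 1 1 0)) (SX
     (SY (Leaf 1 0 0) (Leaf 1 1 1)) (Leaf 1 0 0)))))))
    0 256 (- 128) 128 0 128"
  by code_simp

lemma nf_neg: "nf (- x) (- y) (- z) = - nf x y z"
  by (simp add: nf_def)

lemma nf_close_to_lattice:
  "\<exists>(a::int) (b::int) (c::int). \<bar>nf (x - a) (y - b) (z - c)\<bar> < 1"
proof -
  have *: "\<exists>(a::int) (b::int) (c::int). \<bar>nf (x - a) (y - b) (z - c)\<bar> < 1"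
    if k: "0 \<le> z - of_int k" "z - of_int k \<le> 1 / 2" for x y z :: real and k :: int
  proof -
    define x' y' z' :: real
      where "x' = x - of_int \<lfloor>x\<rfloor>" and "y' = y - of_int (round y)" and "z' = z - of_int k"
    note defs = this
    have "x' \<le> 1" unfolding defs by linarith
    moreover have "0 \<le> x'" "\<bar>y'\<bar> \<le> 1 / 2" "0 \<le> z'" "z' \<le> 1 / 2"
      using k of_int_round_abs_le[of y] unfolding defs by (auto simp: abs_minus_commute)
    ultimately have "\<exists>(a::int) (b::int) (c::int). \<bar>nf (x' - a) (y' - b) (z' - c)\<bar> < 1"
      by (intro covers_sound[OF unit_cube_covered]) (auto simp: abs_le_iff)
    then obtain a b c :: int where "\<bar>nf (x' - a) (y' - b) (z' - c)\<bar> < 1" by blast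
    then have "\<bar>nf (x - of_int (\<lfloor>x\<rfloor> + a)) (y - of_int (round y + b)) (z - of_int (k + c))\<bar> < 1"
      unfolding defs by (simp add: algebra_simps)
    then show ?thesis by blast
  qed
  show ?thesis
  proof (cases "0 \<le> z - round z")
    case True
    then show ?thesis using *[of z "round z"] of_int_round_abs_le[of z] by force
  next
    case False
    \<comment> \<open>Here \<open>z\<close> lies below its nearest integer; negating the whole point
      puts it above.\<close>
    then obtain a b c :: int where "\<bar>nf (- x - a) (- y - b) (- z - c)\<bar> < 1"
      using *[of "- z" "- round z" "- x" "- y"] of_int_round_abs_le[of z] by force
    moreover have "nf (- x - a) (- y - b) (- z - c)
        = - nf (x - of_int (- a)) (y - of_int (- b)) (z - of_int (- c))"
      unfolding nf_neg[symmetric] by (simp add: algebra_simps)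
    ultimately show ?thesis by (metis abs_minus_cancel)
  qed
qed

subsection \<open>Comaximal elements and units\<close>

lemma nf_scale: "nf (k * x) (k * y) (k * z) = k ^ 3 * nf x y z"
  unfolding nf_def by algebra

lemma nrm_of_int [simp]: "nrm (of_int n) = n ^ 3"
  by (simp add: nrm_def)

text \<open>The quotient \<open>x / y\<close> has coordinates \<open>w / n\<close> with
  \<open>w = x * cof y\<close> and \<open>n = nrm y\<close>. A lattice point within norm distance 1
  of it serves as \<open>q\<close>, after clearing denominators.\<close>

lemma zt_euclid:
  assumes "y \<noteq> 0"
  shows "\<exists>q. \<bar>nrm (x - q * y)\<bar> < \<bar>nrm y\<bar>"
proof -
  define n where "n = nrm y"
  define w where "w = x * cof y"
  have n0: "n \<noteq> 0" using assms by (simp add: n_def)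
  obtain a b c :: int where "\<bar>nf (c0 w / n - a) (c1 w / n - b) (c2 w / n - c)\<bar> < 1"
    using nf_close_to_lattice by blast
  then have "\<bar>real_of_int n ^ 3 * nf (c0 w / n - a) (c1 w / n - b) (c2 w / n - c)\<bar> < \<bar>real_of_int n ^ 3\<bar>"
    using n0 by (simp add: abs_mult)
  also have "real_of_int n ^ 3 * nf (c0 w / n - a) (c1 w / n - b) (c2 w / n - c)
      = nrm (w - ZT a b c * of_int n)"
    unfolding nrm_nf nf_scale[symmetric] using n0 by (simp add: zt_coeffs_mult algebra_simps)
  finally have "real_of_int \<bar>nrm (w - ZT a b c * of_int n)\<bar> < real_of_int \<bar>n ^ 3\<bar>" by simp
  then have lt: "\<bar>nrm (w - ZT a b c * of_int n)\<bar> < \<bar>n ^ 3\<bar>" by (simp only: of_int_less_iff)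
  have w: "w - ZT a b c * of_int n = (x - ZT a b c * y) * cof y"
    unfolding w_def n_def cof_mult[symmetric] by (simp add: algebra_simps)
  have "nrm y * nrm (cof y) = n ^ 3"
    unfolding nrm_mult[symmetric] cof_mult n_def by simp
  then have cofn: "nrm (cof y) = n ^ 2" using n0 by (simp add: n_def power2_eq_square power3_eq_cube)
  have "\<bar>nrm (x - ZT a b c * y)\<bar> * n ^ 2 < \<bar>n\<bar> * n ^ 2"
    using lt unfolding w nrm_mult cofn by (simp add: abs_mult power2_eq_square power3_eq_cube)
  then have "\<bar>nrm (x - ZT a b c * y)\<bar> < \<bar>n\<bar>"
    using n0 by (simp add: mult_less_cancel_right)
  then show ?thesis unfolding n_def by blast
qed

lemma zt_bezout: "\<exists>u v. u * x + v * y dvd x \<and> u * x + v * y dvd y" for x y :: zt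
proof (induction "nat \<bar>nrm y\<bar>" arbitrary: x y rule: less_induct)
  case less
  show ?case
  proof (cases "y = 0")
    case True
    then show ?thesis by (intro exI[of _ 1] exI[of _ 0]) simp
  next
    case False
    then obtain q where "\<bar>nrm (x - q * y)\<bar> < \<bar>nrm y\<bar>" using zt_euclid by blast
    then have "nat \<bar>nrm (x - q * y)\<bar> < nat \<bar>nrm y\<bar>" using False by simp
    from less[OF this, of y] obtain u v
      where uv: "u * y + v * (x - q * y) dvd y" "u * y + v * (x - q * y) dvd x - q * y"
      by blast
    have eq: "v * x + (u - v * q) * y = u * y + v * (x - q * y)" by (simp add: algebra_simps)
    have "u * y + v * (x - q * y) dvd x"
      using dvd_add[OF uv(2) dvd_mult[OF uv(1), of q]] by simp
    then show ?thesis using uv(1) unfolding eq[symmetric] by blast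
  qed
qed

definition comaximal :: "zt \<Rightarrow> zt \<Rightarrow> bool" where
  "comaximal x y \<longleftrightarrow> (\<exists>u v. u * x + v * y = 1)"

lemma copI: "u * x + v * y = 1 \<Longrightarrow> comaximal x y"
  by (auto simp: comaximal_def)

lemma comaximal_sym: "comaximal x y \<Longrightarrow> comaximal y x"
  unfolding comaximal_def by (subst ex_comm) (simp add: add.commute)

lemma comaximal_dvd:
  assumes "comaximal x y" "a dvd x" "b dvd y"
  shows "comaximal a b"
proof -
  obtain u v x' y' where "u * x + v * y = 1" "x = a * x'" "y = b * y'"
    using assms unfolding comaximal_def dvd_def by auto
  then have "(u * x') * a + (v * y') * b = 1" by (simp add: algebra_simps)
  then show ?thesis by (rule copI)
qed

lemma comaximal_mult:
  assumes "comaximal x z" "comaximal y z"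
  shows "comaximal (x * y) z"
proof -
  obtain u v u' v' where "u * x + v * z = 1" "u' * y + v' * z = 1"
    using assms unfolding comaximal_def by auto
  then have "(u * u') * (x * y) + (u * x * v' + v * u' * y + v * v' * z) * z = 1"
    by algebra
  then show ?thesis by (rule copI)
qed

lemma comaximal_1 [simp]: "comaximal 1 x" "comaximal x 1"
  by (rule copI[of 1 _ 0]; simp) (rule copI[of 0 _ 1]; simp)

lemma comaximal_power: "comaximal x y \<Longrightarrow> comaximal (x ^ n) (y ^ m)"
proof -
  have "comaximal (x ^ n) y" if "comaximal x y" for n x y
    using that by (induction n) (auto intro: comaximal_mult)
  then show "comaximal x y \<Longrightarrow> ?thesis" by (meson comaximal_sym)
qed

lemma comaximal_dvd_mult:
  assumes "comaximal x y" "x dvd y * z"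
  shows "x dvd z"
proof -
  obtain u v where uv: "u * x + v * y = 1" using assms unfolding comaximal_def by auto
  have "z = (u * x + v * y) * z" using uv by simp
  also have "\<dots> = x * (u * z) + v * (y * z)" by (simp add: algebra_simps)
  finally show ?thesis using assms(2) by (metis dvd_add dvd_mult dvd_triv_left)
qed

lemma unit_comaximal: "x dvd 1 \<Longrightarrow> comaximal x y"
  using comaximal_dvd[OF comaximal_1(1)[of y], of x y] by simp

lemma zt_gcd:
  assumes "x \<noteq> 0 \<or> y \<noteq> 0"
  obtains g x' y' where "g \<noteq> 0" "x = g * x'" "y = g * y'" "comaximal x' y'"
proof -
  obtain u v where uv: "u * x + v * y dvd x" "u * x + v * y dvd y" using zt_bezout by blast
  define g where "g = u * x + v * y"
  obtain x' y' where xy: "x = g * x'" "y = g * y'" using uv unfolding g_def dvd_def by auto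
  have g0: "g \<noteq> 0" using assms xy by auto
  have "g * (u * x' + v * y') = g * 1" using g_def xy by algebra
  then have "comaximal x' y'" using g0 copI by (metis mult_left_cancel)
  then show thesis using that g0 xy by blast
qed

lemma unit_nrm: "x dvd 1 \<longleftrightarrow> \<bar>nrm x\<bar> = 1"
proof
  assume "x dvd 1"
  then obtain y where "1 = x * y" by (auto elim: dvdE)
  then have "nrm x * nrm y = 1" by (metis nrm_0_1(2) nrm_mult)
  then have "nrm x dvd 1" by (metis dvd_triv_left)
  then show "\<bar>nrm x\<bar> = 1" by simp
next
  assume "\<bar>nrm x\<bar> = 1"
  then have "nrm x = 1 \<or> nrm x = -1" by linarith
  then have "x * cof x = 1 \<or> x * (- cof x) = 1" using cof_mult[of x] by auto
  then show "x dvd 1" by (metis dvd_triv_left)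
qed

lemma nrm_power: "nrm (x ^ n) = nrm x ^ n"
  by (induction n) (simp_all add: nrm_mult)

text \<open>After a greatest common divisor is removed, \<open>g'\<close> is comaximal to
  \<open>h'\<close>, so that \<open>g' ^ 2\<close> divides 1.\<close>

lemma sq_dvd_sq:
  assumes "g ^ 2 dvd h ^ 2"
  shows "g dvd (h :: zt)"
proof (cases "g = 0")
  case False
  then obtain c g' h' where c: "c \<noteq> 0" "g = c * g'" "h = c * h'" "comaximal g' h'"
    using zt_gcd[of g h] by blast
  then have "g' ^ 2 dvd 1 * h' ^ 2" using assms by (simp add: power_mult_distrib)
  then have "g' ^ 2 dvd 1"
    using comaximal_dvd_mult[OF comaximal_power[OF c(4)], of 2 2 1] by (simp add: mult.commute)
  then have "g' dvd 1" by (metis dvd_mult_left power2_eq_square)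
  then show ?thesis unfolding c by (meson dvd_refl dvd_trans mult_dvd_mono one_dvd)
qed (use assms in auto)

definition th :: zt where "th = ZT 0 1 0"
text \<open>The inverse of \<open>th\<close>, read off from
  \<open>th * (th^2 + 3) = - 1\<close>.\<close>

definition ti :: zt where "ti = ZT (- 3) 0 (- 1)"

lemma th_ti: "th * ti = 1"
  by (simp add: zt_eq_iff zt_coeffs_mult th_def ti_def)

lemma th_cube: "th ^ 3 + 3 * th + 1 = 0"
  by (simp add: zt_eq_iff zt_coeffs_mult th_def power3_eq_cube)

lemma rl_th [simp]: "rl th = rt" by (simp add: rl_def th_def)

text \<open>\<open>\<bar>rl u\<bar>\<close> lies in a fundamental domain for multiplication by \<open>th\<close>, and all conjugates of \<open>u\<close> are bounded.\<close>
lemma small_unit: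
  assumes "\<bar>nrm u\<bar> = 1" "1 \<le> \<bar>rl u\<bar>" "\<bar>rl u * rt\<bar> < 1"
  shows "u = 1 \<or> u = - 1"
proof -
  define a b c where "a = c0 u" and "b = c1 u" and "c = c2 u"
  \<comment> \<open>Four times the squared absolute value of \<open>u\<close> in the complex
    embedding. Since the norm has absolute value 1 and \<open>\<bar>rl u\<bar>\<close> is at least
    1, it is at most 4.\<close>
  define q where "q = (2 * a - rt * b - (6 + rt ^ 2) * c) ^ 2 + (12 + 3 * rt ^ 2) * (b - rt * c) ^ 2"
  have q0: "0 \<le> q" unfolding q_def by simp
  have "4 * real_of_int (nrm u) = rl u * q"
    unfolding nrm_nf nf_factor q_def rl_def a_def b_def c_def by simp
  then have "\<bar>rl u\<bar> * q = \<bar>4 * real_of_int (nrm u)\<bar>" using q0 by (simp add: abs_mult)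
  also have "\<dots> = 4 * real_of_int \<bar>nrm u\<bar>" by simp
  finally have "\<bar>rl u\<bar> * q = 4" using assms(1) by simp
  then have q4: "q \<le> 4" using mult_right_mono[OF assms(2) q0] by simp
  define X Y where "X = 2 * a - rt * b - (6 + rt ^ 2) * c" and "Y = b - rt * c"
  have qXY: "q = X ^ 2 + 12 * Y ^ 2 + 3 * (rt ^ 2 * Y ^ 2)"
    unfolding q_def X_def Y_def by (simp add: algebra_simps)
  have nn: "0 \<le> X ^ 2" "0 \<le> Y ^ 2" "0 \<le> rt ^ 2 * Y ^ 2" by simp_all
  have "X ^ 2 \<le> 2 ^ 2" using q4 nn unfolding qXY by (simp only: power2_eq_square)
  then have "\<bar>X\<bar> \<le> \<bar>2\<bar>" by (rule abs_le_square_iff[THEN iffD2])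
  then have 1: "\<bar>2 * a - rt * b - (6 + rt ^ 2) * c\<bar> \<le> 2" unfolding X_def by simp
  have "12 * Y ^ 2 \<le> 4" using q4 nn unfolding qXY by linarith
  then have "Y ^ 2 \<le> (6 / 10) ^ 2" by (simp add: power2_eq_square)
  then have "\<bar>Y\<bar> \<le> \<bar>6 / 10\<bar>" by (rule abs_le_square_iff[THEN iffD2])
  then have 2: "\<bar>b - rt * c\<bar> \<le> 6 / 10" unfolding Y_def by simp
  have "\<bar>rl u\<bar> * (3221 / 10000) \<le> \<bar>rl u\<bar> * \<bar>rt\<bar>" using rt_bounds by (intro mult_left_mono) auto
  then have "\<bar>rl u\<bar> * (3221 / 10000) < 1" using assms(3) by (simp add: abs_mult)
  then have 3: "\<bar>a + b * rt + c * rt ^ 2\<bar> < 3105 / 1000" unfolding rl_def a_def b_def c_def by simp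
  have 4: "\<bar>rt * (b - rt * c)\<bar> \<le> 1 / 4"
    using mult_mono[of "\<bar>rt\<bar>" "3222 / 10000" "\<bar>b - rt * c\<bar>" "6 / 10"] 2 rt_bounds
    by (simp add: abs_mult)
  \<comment> \<open>A combination of the three bounded forms in which \<open>a\<close> and
    \<open>b\<close> cancel.\<close>
  have "(6 + 6 * rt ^ 2) * c = 2 * (a + b * rt + c * rt ^ 2) - (2 * a - rt * b - (6 + rt ^ 2) * c)
      - 3 * (rt * (b - rt * c))"
    by (simp add: algebra_simps power2_eq_square)
  moreover have "\<bar>2 * k - l - 3 * m\<bar> < 9" if "\<bar>k\<bar> < 3105 / 1000" "\<bar>l\<bar> \<le> 2" "\<bar>m\<bar> \<le> 1 / 4" for k l m :: real
    using that by linarith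
  ultimately have "\<bar>(6 + 6 * rt ^ 2) * c\<bar> < 9" using 1 3 4 by presburger
  moreover have "6 * \<bar>real_of_int c\<bar> \<le> \<bar>(6 + 6 * rt ^ 2) * c\<bar>"
    unfolding abs_mult by (intro mult_right_mono) auto
  ultimately have "\<bar>real_of_int c\<bar> < 2" by linarith
  then have "c = 0 \<or> c = 1 \<or> c = -1" by linarith
  moreover have False if "c = 1"
  proof -
    have "\<bar>real_of_int b\<bar> < 1" using 2 rt_bounds unfolding that abs_le_iff abs_less_iff by simp
    then have "b = 0" by linarith
    have "a > 2" "a < 4"
      using 1 3 rt_sq_bounds unfolding that \<open>b = 0\<close> by auto
    then have "a = 3" by linarith
    \<comment> \<open>This is \<open>u = - ti\<close>, which lies on the excluded boundary
      \<open>\<bar>rl u * rt\<bar> = 1\<close> of the fundamental domain.\<close>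
    have "rl u = 3 + rt ^ 2" using that \<open>a = 3\<close> \<open>b = 0\<close> unfolding rl_def a_def b_def c_def by simp
    then have "rl u * rt = - 1" using rt_root by algebra
    then show False using assms(3) by simp
  qed
  moreover have False if "c = -1"
  proof -
    have "\<bar>real_of_int b\<bar> < 1" using 2 rt_bounds unfolding that abs_le_iff abs_less_iff by simp
    then have "b = 0" by linarith
    have "a < - 2" "a > - 4"
      using 1 3 rt_sq_bounds unfolding that \<open>b = 0\<close> by auto
    then have "a = - 3" by linarith
    have "rl u = - 3 - rt ^ 2" using that \<open>a = - 3\<close> \<open>b = 0\<close> unfolding rl_def a_def b_def c_def by simp
    then have "rl u * rt = 1" using rt_root by algebra
    then show False using assms(3) by simp
  qed
  ultimately have c: "c = 0" by blast
  then have b: "b = 0" using 2 by auto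
  have "\<bar>a\<bar> \<le> 1" using 1 unfolding b c by auto
  moreover have "a \<noteq> 0" using assms(2)
    unfolding rl_def a_def[symmetric] b_def[symmetric] c_def[symmetric] b c
    by auto
  ultimately have "a = 1 \<or> a = -1" by linarith
  then show ?thesis using b c unfolding a_def b_def c_def zt_eq_iff by auto
qed

lemma big_unit:
  assumes "\<bar>nrm u\<bar> = 1" "1 \<le> \<bar>rl u\<bar>"
  shows "\<exists>n. u * th ^ n = 1 \<or> u * th ^ n = - 1"
proof -
  have rp: "0 < \<bar>rl u\<bar>" using assms(2) by linarith
  have "0 < 1 / \<bar>rl u\<bar>" using assms(2) by (cases "u = 0") auto
  then have "\<exists>n. \<bar>rt\<bar> ^ n < 1 / \<bar>rl u\<bar>"
    using rt_bounds by (intro real_arch_pow_inv) auto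
  \<comment> \<open>With \<open>n\<close> minimal, \<open>m = n - 1\<close> is the last exponent for
    which the absolute value stays at least 1.\<close>
  then obtain n where n: "\<bar>rt\<bar> ^ n < 1 / \<bar>rl u\<bar>" "\<And>m. m < n \<Longrightarrow> \<not> \<bar>rt\<bar> ^ m < 1 / \<bar>rl u\<bar>"
    using exists_least_iff[of "\<lambda>n. \<bar>rt\<bar> ^ n < 1 / \<bar>rl u\<bar>"] by blast
  have "1 / \<bar>rl u\<bar> \<le> 1" using assms(2) by (auto simp: divide_le_eq_1)
  then have "n \<noteq> 0" using n(1) by (cases n) auto
  then obtain m where m: "n = Suc m" by (cases n) auto
  have "nrm th = -1" by (simp add: nrm_def th_def)
  then have "\<bar>nrm (u * th ^ m)\<bar> = 1" using assms(1) by (simp add: nrm_mult nrm_power abs_mult)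
  moreover have "1 \<le> \<bar>rl (u * th ^ m)\<bar>"
    using n(2)[of m] m rp by (simp add: abs_mult power_abs not_less pos_divide_le_eq mult.commute)
  moreover have "\<bar>rl (u * th ^ m) * rt\<bar> < 1"
    using n(1) m rp by (simp add: abs_mult power_abs pos_less_divide_eq mult_ac)
  ultimately show ?thesis using small_unit by blast
qed

text \<open>Units are \<open>th ^ n\<close> or \<open>ti ^ n\<close> up to sign; modulo squares only
  the parity of \<open>n\<close> matters, and \<open>ti = th * ti ^ 2\<close>. A unit that is small
  at the real place is handled through its inverse.\<close>

lemma unit_class:
  assumes "u dvd 1"
  obtains e w where "e \<in> {1, -1, th, -th}" "u = e * w ^ 2"
proof -
  obtain u' where u': "u * u' = 1" using assms by (auto elim: dvdE)
  have *: "\<exists>e\<in>{1, -1, th, -th}. \<exists>w. s * p ^ n = e * w ^ 2"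
    if "s = 1 \<or> s = -1" "p = th \<or> p = ti" for s p n
  proof -
    have ti: "ti = th * ti ^ 2" using th_ti by algebra
    define k where "k = n div 2"
    have p: "p ^ n = (p ^ k) ^ 2 \<or> p ^ n = p * (p ^ k) ^ 2"
    proof (cases "even n")
      case True
      then have "n = k * 2" unfolding k_def by simp
      then show ?thesis by (simp add: power_mult)
    next
      case False
      then have "n = Suc (k * 2)" unfolding k_def by presburger
      then show ?thesis by (simp add: power_mult)
    qed
    have "\<exists>e\<in>{1, th}. \<exists>w. p ^ n = e * w ^ 2"
      using p that(2)
    proof (elim disjE)
      assume a: "p ^ n = p * (p ^ k) ^ 2" "p = ti"
      have "p ^ n = th * (ti * p ^ k) ^ 2"
        using a ti by (metis mult.assoc power_mult_distrib)
      then show ?thesis by blast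
    qed auto
    then show ?thesis using that(1) by auto
  qed
  have nu: "\<bar>nrm u\<bar> = 1" "\<bar>nrm u'\<bar> = 1" using u' unit_nrm by (metis dvd_triv_left, metis dvd_triv_right)
  have inv: "u = s * p'^ n" if "u * p ^ n = s" "p * p' = 1" for p p' s :: zt and n
  proof -
    have "u = u * (p * p') ^ n" using that by simp
    also have "\<dots> = (u * p ^ n) * p' ^ n" by (simp add: power_mult_distrib mult.assoc)
    finally show ?thesis using that by simp
  qed
  have "\<exists>s p n. u = s * p ^ n \<and> (s = 1 \<or> s = -1) \<and> (p = th \<or> p = ti)"
  proof (cases "1 \<le> \<bar>rl u\<bar>")
    case True
    then obtain n where "u * th ^ n = 1 \<or> u * th ^ n = - 1" using big_unit nu by blast
    then show ?thesis using inv[of th n _ ti] th_ti by blast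
  next
    case False
    have "rl u * rl u' = 1" using u' by (simp flip: rl_mult)
    then have "\<bar>rl u\<bar> * \<bar>rl u'\<bar> = 1" by (metis abs_1 abs_mult)
    then have "1 \<le> \<bar>rl u'\<bar>"
      using False mult_left_le[of "\<bar>rl u'\<bar>" "\<bar>rl u\<bar>"] by linarith
    then obtain n where n: "u' * th ^ n = 1 \<or> u' * th ^ n = - 1" using big_unit nu by blast
    have uth: "u * (u' * th ^ n) = th ^ n" using u' by (simp add: mult.assoc[symmetric])
    have "u = 1 * th ^ n \<or> u = - 1 * th ^ n"
      using n
    proof
      assume "u' * th ^ n = 1"
      then have "u = th ^ n" using uth by (simp only: mult_1_right)
      then show ?thesis by simp
    next
      assume "u' * th ^ n = - 1"
      then have "- u = th ^ n"
        using uth by (simp only: mult_minus_right mult_1_right)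
      then have "u = - (th ^ n)" by (metis minus_minus)
      then show ?thesis by simp
    qed
    then show ?thesis by blast
  qed
  then obtain s p n where spn: "u = s * p ^ n" "s = 1 \<or> s = -1" "p = th \<or> p = ti" by blast
  from *[OF spn(2,3), of n] that show thesis unfolding spn(1) by blast
qed

subsection \<open>Square classes\<close>

lemma of_int_dvd_iff: "of_int n dvd x \<longleftrightarrow> n dvd c0 x \<and> n dvd c1 x \<and> n dvd c2 x"
proof
  assume "of_int n dvd x"
  then obtain y where "x = of_int n * y" by (auto elim: dvdE)
  then show "n dvd c0 x \<and> n dvd c1 x \<and> n dvd c2 x" by (simp add: zt_coeffs_mult)
next
  assume "n dvd c0 x \<and> n dvd c1 x \<and> n dvd c2 x"
  then obtain a b c where "c0 x = n * a" "c1 x = n * b" "c2 x = n * c" by (auto elim!: dvdE)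
  then have "x = of_int n * ZT a b c" by (simp add: zt_eq_iff zt_coeffs_mult)
  then show "of_int n dvd x" by simp
qed

lemma numeral_dvd_iff:
  "(numeral n :: zt) dvd x \<longleftrightarrow> numeral n dvd c0 x \<and> numeral n dvd c1 x \<and> numeral n dvd c2 x"
  using of_int_dvd_iff[of "numeral n" x] by simp

lemma two_dvd_iff: "(2::zt) dvd x \<longleftrightarrow> even (nrm x)"
  unfolding numeral_dvd_iff nrm_even ..

lemma two_prime: "(2::zt) dvd x * y \<longleftrightarrow> 2 dvd x \<or> 2 dvd y"
  unfolding two_dvd_iff nrm_mult by simp

lemma two_dvd_power: "(2::zt) dvd x ^ n \<longleftrightarrow> 2 dvd x \<and> 0 < n"
  unfolding two_dvd_iff nrm_power by simp

lemma residue: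
  assumes "0 < m"
  obtains a b c where "a \<in> {0..<m}" "b \<in> {0..<m}" "c \<in> {0..<m}" "of_int m dvd x - ZT a b c"
proof
  show "of_int m dvd x - ZT (c0 x mod m) (c1 x mod m) (c2 x mod m)"
    unfolding of_int_dvd_iff by (simp add: mod_eq_dvd_iff[symmetric])
qed (use assms in auto)

lemma cong_power: "d dvd x - y \<Longrightarrow> d dvd x ^ n - y ^ n" for d x y :: zt
  by (metis dvd_mult2 power_diff_sumr2)

lemma ZT_mult: "ZT a b c * ZT d e f = ZT (a * d - b * f - c * e)
    (a * e + b * d - 3 * (b * f + c * e) - c * f) (a * f + b * e + c * d - 3 * (c * f))"
  by (simp add: times_zt_def)

lemma ZT_arith:
  "ZT a b c + ZT d e f = ZT (a + d) (b + e) (c + f)"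
  "ZT a b c - ZT d e f = ZT (a - d) (b - e) (c - f)"
  "- ZT a b c = ZT (- a) (- b) (- c)"
  by (simp_all add: zt_eq_iff)

lemma ZT_seventh: "ZT a b c ^ 7 = (let y = ZT a b c; y2 = y * y; y4 = y2 * y2 in y4 * (y2 * y))"
  by (simp add: Let_def eval_nat_numeral mult_ac)

lemma set_lt_2: "{0..<2} = {0, 1::int}" and set_lt_4: "{0..<4} = {0, 1, 2, 3::int}"
  by auto

text \<open>
  2 is inert, so an odd \<open>x\<close> satisfies \<open>x^7 = 1\<close> modulo 2. Hence \<open>x\<close> is a square modulo 4 if and only if
  \<open>x^7 = 1\<close> modulo 4, which is the test applied to square classes below.
\<close>
lemma seventh_power_mod_2:
  assumes "\<not> (2::zt) dvd x"
  shows "2 dvd x ^ 7 - 1"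
proof -
  obtain a b c where abc: "a \<in> {0..<2::int}" "b \<in> {0..<2::int}" "c \<in> {0..<2::int}"
    and r: "of_int 2 dvd x - ZT a b c"
    by (rule residue[of 2 x]) auto
  have "\<not> 2 dvd ZT a b c" using assms r
    by (metis dvd_diff diff_diff_eq2 add_diff_cancel_left' diff_add_cancel dvd_add_left_iff of_int_numeral)
  then have "2 dvd ZT a b c ^ 7 - 1"
    using abc unfolding set_lt_2
    by (auto simp: numeral_dvd_iff ZT_seventh ZT_mult Let_def)
  moreover have "2 dvd x ^ 7 - ZT a b c ^ 7" using cong_power[OF r, of 7] by simp
  ultimately have "2 dvd (x ^ 7 - ZT a b c ^ 7) + (ZT a b c ^ 7 - 1)" by (rule dvd_add[rotated])
  then show ?thesis by simp
qed

lemma fourteenth_power_mod_4: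
  assumes "\<not> (2::zt) dvd x"
  shows "4 dvd x ^ 14 - 1"
proof -
  obtain y where "x ^ 7 - 1 = 2 * y" using seventh_power_mod_2[OF assms] by (auto elim: dvdE)
  then have "x ^ 14 - 1 = 4 * (y + y ^ 2)"
    using power_mult[of x 7 2] by (simp add: power2_eq_square) algebra
  then show ?thesis by simp
qed

text \<open>For odd \<open>s\<close>, division by \<open>s ^ 2\<close> would give
  \<open>v^2 + v = 1 + th^2\<close> over the field with 8 elements, where the right-hand side has
  trace 1. The proof compares the parities of the coordinates.\<close>

lemma artin_schreier_unsolvable:
  assumes "2 dvd w ^ 2 + w * s - (1 + th ^ 2) * s ^ 2"
  shows "(2::zt) dvd s"
proof -
  have "even (c0 s) \<and> even (c1 s) \<and> even (c2 s)"
    using assms unfolding numeral_dvd_iff power2_eq_square th_def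
    by (auto simp: zt_coeffs_mult even_add)
  then show ?thesis unfolding numeral_dvd_iff .
qed

section \<open>Primes above 3 and 5 and their residue maps\<close>

definition p3 :: zt where "p3 = 1 + th"
definition p5 :: zt where "p5 = 1 - th"
definition q5 :: zt where "q5 = 1 + 2 * th"
text \<open>\<open>alpha\<close> arises from \<open>p - q * th\<close> with
  \<open>p = s^2 + 2 r^2\<close> and \<open>q = r^2\<close>. The norm of
  \<open>s^2 + beta r^2\<close> is the sextic form of \<open>second_norm_square\<close>.\<close>

definition alpha :: zt where "alpha = 2 - th"
definition beta :: zt where "beta = 1 - th ^ 2"

lemma alpha_eq: "alpha = p3 * q5 * ti ^ 2"
  by (simp add: zt_eq_iff zt_coeffs_mult th_def ti_def alpha_def p3_def q5_def eval_nat_numeral)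

lemma beta_eq: "beta = p3 * p5"
  by (simp add: beta_def p3_def p5_def algebra_simps power2_eq_square)

lemma beta_alpha: "beta - alpha = ti * p3 ^ 2"
  by (simp add: zt_eq_iff zt_coeffs_mult th_def ti_def alpha_def beta_def p3_def eval_nat_numeral)

lemma zt_literals: "th = ZT 0 1 0" "ti = ZT (- 3) 0 (- 1)" "p3 = ZT 1 1 0" "p5 = ZT 1 (- 1) 0"
    "q5 = ZT 1 2 0"
  "alpha = ZT 2 (- 1) 0" "beta = ZT 1 0 (- 1)"
  by (simp_all add: zt_eq_iff zt_coeffs_mult th_def ti_def alpha_def beta_def p3_def p5_def q5_def eval_nat_numeral)

lemma nrm_literals: "nrm th = - 1" "nrm ti = - 1" "nrm p3 = 3" "nrm p5 = 5" "nrm q5 = 5"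
    "nrm alpha = 15" "nrm beta = 15"
  by (simp_all add: nrm_def zt_literals eval_nat_numeral)

text \<open>
  Evaluation at \<open>th = t\<close>; it induces the residue maps at \<open>p3\<close> (\<open>t = - 1\<close>), \<open>p5\<close> (\<open>t = 1\<close>) and
  \<open>q5\<close> (\<open>t = 2\<close>). Up to units, 5 is \<open>p5 * q5 ^ 2\<close>.
\<close>
definition chi :: "int \<Rightarrow> zt \<Rightarrow> int" where
  "chi t x = c0 x + c1 x * t + c2 x * t ^ 2"

lemma chi_add [simp]: "chi t (x + y) = chi t x + chi t y" "chi t (x - y) = chi t x - chi t y"
  by (simp_all add: chi_def algebra_simps)

lemma chi_mult: "t ^ 3 + 3 * t + 1 dvd chi t (x * y) - chi t x * chi t y"
proof -
  have "chi t (x * y) - chi t x * chi t y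
    = (t ^ 3 + 3 * t + 1) * (- c1 x * c2 y - c2 x * c1 y - c2 x * c2 y * t)"
    unfolding chi_def zt_coeffs_mult by algebra
  then show ?thesis by simp
qed

definition maximal_elt :: "zt \<Rightarrow> bool" where
  "maximal_elt p \<longleftrightarrow> p \<noteq> 0 \<and> (\<forall>x. p dvd x \<or> comaximal p x)"

lemma chi_dvd: "th - of_int t dvd x - of_int (chi t x)"
proof -
  have "x - of_int (chi t x) = (th - of_int t) * (of_int (c1 x) + of_int (c2 x) * (th + of_int t))"
    by (simp add: zt_eq_iff zt_coeffs_mult chi_def th_def power2_eq_square algebra_simps)
  then show ?thesis by simp
qed

text \<open>Modulo \<open>p\<close> every \<open>x\<close> equals the integer
  \<open>chi t x\<close>, and \<open>n\<close> vanishes. Both claims thus reduce to divisibility and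
  Bezout identities in the integers.\<close>

lemma maximal_elt_by_chi:
  assumes "p dvd th - of_int t" "p dvd of_int n" "prime n" "p \<noteq> 0"
  shows "maximal_elt p" "n dvd chi t x \<Longrightarrow> p dvd x"
proof -
  have k: "p dvd x - of_int (chi t x)" for x using chi_dvd assms(1) dvd_trans by blast
  have 1: "p dvd x" if "n dvd chi t x" for x
  proof -
    have "p dvd of_int (chi t x)" using that assms(2) by (metis dvd_mult2 dvd_def of_int_mult)
    then show ?thesis using k[of x] by (metis diff_add_cancel dvd_add)
  qed
  then show "n dvd chi t x \<Longrightarrow> p dvd x" .
  have "comaximal p x" if "\<not> n dvd chi t x" for x
  proof -
    have "coprime n (chi t x)" using assms(3) that by (simp add: prime_imp_coprime)
    then obtain u v where uv: "u * n + v * chi t x = 1"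
      using bezout_int[of n "chi t x"] by auto
    obtain m where m: "of_int n = p * m" using assms(2) by (auto elim: dvdE)
    obtain l where l: "x - of_int (chi t x) = p * l" using k by (auto elim: dvdE)
    have "(of_int u * m - of_int v * l) * p + of_int v * x
      = of_int u * (p * m) + of_int v * (x - p * l)" by (simp add: algebra_simps)
    also have "\<dots> = of_int (u * n + v * chi t x)" unfolding m[symmetric] l[symmetric] by simp
    finally show ?thesis using uv copI by simp
  qed
  then show "maximal_elt p" unfolding maximal_elt_def using 1 assms(4) by blast
qed

lemma maximal_elt_p3: "maximal_elt p3"
  and p5_dvd: "5 dvd chi 1 x \<Longrightarrow> p5 dvd x" and maximal_elt_p5: "maximal_elt p5"
  and q5_dvd: "5 dvd chi 2 x \<Longrightarrow> q5 dvd x" and maximal_elt_q5: "maximal_elt q5"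
proof -
  have cof: "p dvd of_int (nrm p)" for p unfolding cof_mult[symmetric] by simp
  have nz: "p3 \<noteq> 0" "p5 \<noteq> 0" "q5 \<noteq> 0" using nrm_literals by auto
  have p3: "prime (3::int)" "prime (5::int)" by simp_all
  have pd: "p3 dvd th - of_int (- 1)" "p5 dvd th - of_int 1" "q5 dvd th - of_int 2"
  proof -
    show "p3 dvd th - of_int (- 1)" by (simp add: p3_def add.commute)
    have "th - of_int 1 = p5 * (- 1)" by (simp add: p5_def)
    then show "p5 dvd th - of_int 1" by (metis dvd_triv_left)
    have "th - of_int 2 = q5 * (- p3 * ti ^ 2)" using alpha_eq unfolding alpha_def
      by (simp add: algebra_simps)
    then show "q5 dvd th - of_int 2" by (metis dvd_triv_left)
  qed
  show "maximal_elt p3"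
    using maximal_elt_by_chi[OF pd(1) _ p3(1) nz(1)] cof[of p3] nrm_literals by auto
  show "5 dvd chi 1 x \<Longrightarrow> p5 dvd x" "maximal_elt p5"
    using maximal_elt_by_chi[OF pd(2) _ p3(2) nz(2)] cof[of p5] nrm_literals by auto
  show "5 dvd chi 2 x \<Longrightarrow> q5 dvd x" "maximal_elt q5"
    using maximal_elt_by_chi[OF pd(3) _ p3(2) nz(3)] cof[of q5] nrm_literals by auto
qed

lemma maximal_elt_split:
  assumes "maximal_elt p" "x * y = p * k"
  obtains x1 where "x = p * x1" "x1 * y = k" | y1 where "y = p * y1" "x * y1 = k"
proof -
  have p0: "p \<noteq> 0" using assms(1) by (simp add: maximal_elt_def)
  consider "p dvd x" | "p dvd y"
    using assms comaximal_dvd_mult[of p x y] unfolding maximal_elt_def by (metis dvd_triv_left)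
  then show thesis
  proof cases
    case 1
    then obtain x1 where x1: "x = p * x1" by (auto elim: dvdE)
    then have "x1 * y = k" using assms(2) p0 by (simp add: mult.assoc)
    then show thesis using that(1) x1 by blast
  next
    case 2
    then obtain y1 where y1: "y = p * y1" by (auto elim: dvdE)
    then have "x * y1 = k" using assms(2) p0 by (simp add: mult.left_commute)
    then show thesis using that(2) y1 by blast
  qed
qed

text \<open>The flags are the exponents modulo 2 of \<open>- 1\<close>, \<open>th\<close>,
  \<open>p3\<close>, \<open>p5\<close>, \<open>q5\<close>; multiplying square classes becomes
  exclusive or.\<close>

definition class_rep ::
    "bool \<Rightarrow> bool \<Rightarrow> bool \<Rightarrow> bool \<Rightarrow> bool \<Rightarrow> zt" where
  "class_rep a b c d e = (if a then - 1 else 1) * (if b then th else 1) * (if c then p3 else 1)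
     * (if d then p5 else 1) * (if e then q5 else 1)"

definition in_class ::
    "bool \<Rightarrow> bool \<Rightarrow> bool \<Rightarrow> bool \<Rightarrow> bool \<Rightarrow> zt \<Rightarrow> bool" where
  "in_class a b c d e x \<longleftrightarrow> (\<exists>w. x = class_rep a b c d e * w ^ 2)"

lemma class_rep_mult:
  "class_rep a b c d e * class_rep a' b' c' d' e' = class_rep (a \<noteq> a') (b \<noteq> b') (c \<noteq> c') (d \<noteq> d') (e \<noteq> e')
     * ((if b \<and> b' then th else 1) * (if c \<and> c' then p3 else 1)
       * (if d \<and> d' then p5 else 1) * (if e \<and> e' then q5 else 1)) ^ 2"
proof -
  have *: "(if p then x else 1) * (if q then x else 1)
    = (if p \<noteq> q then x else 1) * (if p \<and> q then x else 1) ^ 2" for p q and x :: zt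
    by (simp add: power2_eq_square)
  have s: "(if a then - 1 else 1) * (if a' then - 1 else (1::zt)) = (if a \<noteq> a' then - 1 else 1)"
    by simp
  have "class_rep a b c d e * class_rep a' b' c' d' e'
    = ((if a then - 1 else 1) * (if a' then - 1 else 1))
     * ((if b then th else 1) * (if b' then th else 1))
     * ((if c then p3 else 1) * (if c' then p3 else 1))
     * ((if d then p5 else 1) * (if d' then p5 else 1))
     * ((if e then q5 else 1) * (if e' then q5 else 1))"
    unfolding class_rep_def by (simp only: mult_ac)
  also have "\<dots> = class_rep (a \<noteq> a') (b \<noteq> b') (c \<noteq> c') (d \<noteq> d') (e \<noteq> e')
     * ((if b \<and> b' then th else 1) * (if c \<and> c' then p3 else 1)
       * (if d \<and> d' then p5 else 1) * (if e \<and> e' then q5 else 1)) ^ 2"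
    unfolding s unfolding * unfolding class_rep_def power_mult_distrib by (simp only: mult_ac)
  finally show ?thesis .
qed

lemma in_class_mult:
  assumes "in_class a b c d e x" "in_class a' b' c' d' e' y"
  shows "in_class (a \<noteq> a') (b \<noteq> b') (c \<noteq> c') (d \<noteq> d') (e \<noteq> e') (x * y)"
proof -
  obtain v w where v: "x = class_rep a b c d e * v ^ 2" and w: "y = class_rep a' b' c' d' e' * w ^ 2"
    using assms unfolding in_class_def by blast
  have "x * y = (class_rep a b c d e * class_rep a' b' c' d' e') * (v * w) ^ 2"
    unfolding v w power_mult_distrib by (simp only: mult_ac)
  then show ?thesis unfolding class_rep_mult in_class_def by (metis mult.assoc power_mult_distrib)
qed

lemma unit_in_class: "u dvd 1 \<Longrightarrow> \<exists>a b. in_class a b False False False u"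
proof (erule unit_class)
  fix e w assume "e \<in> {1, - 1, th, - th}" "u = e * w ^ 2"
  moreover have "1 = class_rep False False False False False" "-1 = class_rep True False False False False"
    "th = class_rep False True False False False" "- th = class_rep True True False False False"
    by (simp_all add: class_rep_def)
  ultimately show ?thesis unfolding in_class_def by (metis insertE singletonD)
qed

lemma in_class_literals: "in_class False False True False False p3"
    "in_class False False False True False p5"
  "in_class False False False False True q5"
  unfolding in_class_def by (rule exI[of _ 1]; simp add: class_rep_def)+

lemma in_class_square: "in_class False False False False False (w ^ 2)"
  unfolding in_class_def class_rep_def by auto

text \<open>A finite check: \<open>1\<close>, \<open>th * p3 * p5\<close>, \<open>- p3\<close> and
  \<open>- th * p5\<close> are the representatives that are squares modulo 4.\<close>

lemma class_rep_seventh: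
  "4 dvd class_rep a b c d e ^ 7 - 1 \<longleftrightarrow>
    \<not> e \<and> (a, b, c, d) \<in> {(False, False, False, False), (False, True, True, True),
      (True, False, True, False), (True, True, False, True)}"
  by (cases a; cases b; cases c; cases d; cases e)
    (simp_all add: class_rep_def zt_literals ZT_mult ZT_arith ZT_seventh Let_def numeral_dvd_iff)

lemma in_class_seventh:
  assumes "in_class a b c d e x" "\<not> 2 dvd x"
  shows "4 dvd x ^ 7 - class_rep a b c d e ^ 7"
proof -
  obtain w where w: "x = class_rep a b c d e * w ^ 2" using assms unfolding in_class_def by blast
  then have "\<not> 2 dvd w" using assms(2) by (auto simp: two_prime two_dvd_power)
  then have "4 dvd class_rep a b c d e ^ 7 * (w ^ 14 - 1)" using fourteenth_power_mod_4 by simp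
  also have "class_rep a b c d e ^ 7 * (w ^ 14 - 1) = x ^ 7 - class_rep a b c d e ^ 7"
    unfolding w power_mult_distrib by (simp add: algebra_simps flip: power_mult)
  finally show ?thesis .
qed

text \<open>An odd \<open>x\<close> and its representative differ by an odd square, whose seventh
  power is 1 modulo 4. So if \<open>x\<close> is a square modulo 4, its representative passes the
  seventh power test.\<close>

lemma in_class_mod_4:
  assumes "in_class a b c d e x" "4 dvd x - s ^ 2" "\<not> 2 dvd s"
  shows "4 dvd class_rep a b c d e ^ 7 - 1"
proof -
  have "(2::zt) dvd 4" by (simp add: numeral_dvd_iff)
  then have "2 dvd x - s ^ 2" using assms(2) dvd_trans by blast
  then have "\<not> 2 dvd x" using assms(3)
    by (metis diff_add_cancel dvd_diff_commute dvd_diff_right_iff dvd_add_right_iff two_dvd_power)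
  from in_class_seventh[OF assms(1) this] have 1: "4 dvd x ^ 7 - class_rep a b c d e ^ 7" .
  have "(s ^ 2) ^ 7 = s ^ 14" by (simp flip: power_mult)
  then have 2: "4 dvd x ^ 7 - s ^ 14" using cong_power[OF assms(2), of 7] by simp
  have "class_rep a b c d e ^ 7 - 1 = (x ^ 7 - s ^ 14) + (s ^ 14 - 1) - (x ^ 7
      - class_rep a b c d e ^ 7)" by simp
  then show ?thesis using 1 2 fourteenth_power_mod_4[OF assms(3)] by (metis dvd_add dvd_diff)
qed

section \<open>Square classes of the factors of a product\<close>

lemma coprime_square_factor:
  assumes "comaximal x y" "x * y = e * z ^ 2" "e dvd 1"
  shows "\<exists>a b. in_class a b False False False x"
proof (cases "x = 0")
  case True
  then have "x = class_rep False False False False False * 0 ^ 2" by simp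
  then show ?thesis unfolding in_class_def by blast
next
  case False
  \<comment> \<open>\<open>g\<close> is the gcd of \<open>x\<close> and \<open>z\<close>. It will
    follow that \<open>x'\<close> and \<open>g\<close> divide each other, whence
    \<open>x = u * g ^ 2\<close> for a unit \<open>u\<close>.\<close>
  then obtain g x' z' where g: "g \<noteq> 0" "x = g * x'" "z = g * z'" "comaximal x' z'"
    using zt_gcd[of x z] by blast
  obtain e' where e': "e * e' = 1" using assms(3) by (auto elim: dvdE)
  have "g * (x' * y) = g * (g * (e * z' ^ 2))"
    using assms(2) unfolding g by (simp add: power2_eq_square mult_ac)
  then have eq: "x' * y = g * (e * z' ^ 2)" using g(1) by simp
  have "comaximal x' (z' ^ 2)" using comaximal_power[OF g(4), of 1 2] by simp
  moreover have "x' dvd z' ^ 2 * (g * e)" using eq by (metis dvd_triv_left mult.assoc mult.commute)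
  ultimately have "x' dvd g * e" using comaximal_dvd_mult by blast
  then have "x' dvd g * e * e'" by simp
  then have xg: "x' dvd g" using e' by (simp add: mult.assoc)
  have "comaximal g y" using comaximal_dvd[OF assms(1)] g(2) by simp
  moreover have "g dvd y * x'" using eq by (metis dvd_triv_left mult.commute)
  ultimately have "g dvd x'" using comaximal_dvd_mult by blast
  then obtain u where u: "x' = g * u" by (auto elim: dvdE)
  have "g * u dvd g * 1" using xg u by simp
  then have "u dvd 1" using g(1) by simp
  then obtain a b where "in_class a b False False False u" using unit_in_class by blast
  from in_class_mult[OF this in_class_square[of g]] have
      "in_class a b False False False (u * g ^ 2)" by simp
  moreover have "x = u * g ^ 2" unfolding g(2) u by (simp add: power2_eq_square mult_ac)
  ultimately show ?thesis by metis
qed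

text \<open>\<open>b ^ 13\<close> inverts \<open>b\<close> modulo 4, because \<open>b ^ 14\<close>
  is 1 there.\<close>

lemma odd_inverse:
  assumes "\<not> (2::zt) dvd b"
  shows "comaximal (2 ^ n) b" "4 dvd a * b \<Longrightarrow> 4 dvd a"
proof -
  obtain c where c: "b ^ 14 - 1 = 4 * c"
    using fourteenth_power_mod_4[OF assms] by (auto elim: dvdE)
  have "(- 2 * c) * 2 + b ^ 13 * b = 1"
    using c by (simp add: eval_nat_numeral algebra_simps)
  then have "comaximal 2 b" by (rule copI)
  then show "comaximal (2 ^ n) b" using comaximal_power[of 2 b n 1] by simp
  assume "4 dvd a * b"
  moreover have "a = (a * b) * b ^ 13 - 4 * (a * c)"
    using c by (simp add: eval_nat_numeral algebra_simps)
  ultimately show "4 dvd a" by (metis dvd_diff dvd_mult2 dvd_triv_left)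
qed

text \<open>As 2 is prime and \<open>z - s\<close>, \<open>z + s\<close> agree modulo 2, one may
  write \<open>z = s + 2 * u\<close>.\<close>

lemma halve:
  fixes z :: zt
  assumes "s ^ 2 + x * (2 * r) ^ 2 = z ^ 2"
  shows "\<exists>u. u * (u + s) = x * r ^ 2"
proof -
  have "(z - s) * (z + s) = 2 * (2 * (x * r ^ 2))" using assms by algebra
  then have "2 dvd (z - s) * (z + s)" by (metis dvd_triv_left)
  moreover have "z + s = (z - s) + 2 * s" by simp
  ultimately have "2 dvd z - s" unfolding two_prime by (metis dvd_add_left_iff dvd_triv_left)
  then obtain u where u: "z - s = 2 * u" by (auto elim: dvdE)
  then have "z = s + 2 * u" by (simp add: algebra_simps)
  then have "4 * (u * (u + s)) = 4 * (x * r ^ 2)" using assms by algebra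
  then show ?thesis by auto
qed

text \<open>\<open>w\<close> and \<open>- (w + k)\<close> solve the same equation; they correspond
  to the two signs of the square root in \<open>halve\<close>. One of \<open>w\<close>,
  \<open>w + k\<close> is odd, so 4 divides the other.\<close>

lemma choose_sign:
  assumes "w * (w + k) = e * r ^ 2" "2 dvd r" "\<not> (2::zt) dvd k"
  shows "\<exists>u. u * (u + k) = e * r ^ 2 \<and> 4 dvd u"
proof -
  obtain r' where "r = 2 * r'" using assms(2) by (auto elim: dvdE)
  then have 4: "4 dvd w * (w + k)" unfolding assms(1) by (simp add: power_mult_distrib)
  show ?thesis
  proof (cases "2 dvd w")
    case True
    then have "\<not> 2 dvd w + k" using assms(3) by (simp add: dvd_add_right_iff)
    then show ?thesis using odd_inverse(2) 4 assms(1) by blast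
  next
    case False
    then have "4 dvd w + k" using odd_inverse(2)[of w "w + k"] 4 by (simp add: mult.commute)
    then have "4 dvd - (w + k)" by (simp only: dvd_minus_iff)
    moreover have "- (w + k) * (- (w + k) + k) = e * r ^ 2" using assms(1) by algebra
    ultimately show ?thesis by blast
  qed
qed

lemma in_class_partner:
  assumes "in_class a b False False False x" "x * y = z ^ 2" "x \<noteq> 0"
  shows "in_class a b False False False y"
proof -
  obtain w where w: "x = class_rep a b False False False * w ^ 2" using assms(1)
    unfolding in_class_def by blast
  define e where "e = class_rep a b False False False"
  define e' where "e' = (if a then - 1 else 1) * (if b then ti else 1)"
  have ee: "e * e' = 1" unfolding e_def e'_def class_rep_def using th_ti by auto
  have "w ^ 2 dvd z ^ 2" using w assms(2) by (metis dvd_mult2 dvd_triv_right)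
  then obtain z' where z: "z = w * z'" using sq_dvd_sq by (metis dvdE)
  have "w ^ 2 * (e * y) = w ^ 2 * z' ^ 2"
    using assms(2) unfolding w z e_def by (simp add: power_mult_distrib mult_ac)
  moreover have "w \<noteq> 0" using assms(3) w by auto
  ultimately have "e * y = z' ^ 2" by simp
  then have "y = e * (e' * z') ^ 2" using ee by algebra
  then show ?thesis unfolding in_class_def e_def by blast
qed

lemma in_class_divisor_unit:
  assumes "x * y = t" "t dvd 1"
  shows "\<exists>a b. in_class a b False False False x"
proof -
  have "x dvd t" using assms(1) by auto
  then have "x dvd 1" using assms(2) by (rule dvd_trans)
  then show ?thesis by (rule unit_in_class)
qed

lemma in_class_divisor_q5:
  assumes "x * y = q5 * t" "t dvd 1"
  shows "\<exists>a b e. in_class a b False False e x"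
  using maximal_elt_q5 assms(1)
proof (cases rule: maximal_elt_split)
  case (1 x1)
  then obtain a b where "in_class a b False False False x1" using in_class_divisor_unit assms(2) by blast
  from in_class_mult[OF in_class_literals(3) this] show ?thesis using 1 by auto
next
  case (2 y1)
  then show ?thesis using in_class_divisor_unit assms(2) by blast
qed

lemma in_class_divisor_p3_q5:
  assumes "x * y = p3 * (q5 * t)" "t dvd 1"
  shows "\<exists>a b c e. in_class a b c False e x"
  using maximal_elt_p3 assms(1)
proof (cases rule: maximal_elt_split)
  case (1 x1)
  then obtain a b e where "in_class a b False False e x1" using in_class_divisor_q5 assms(2) by blast
  from in_class_mult[OF in_class_literals(1) this] show ?thesis using 1 by auto
next
  case (2 y1)
  then show ?thesis using in_class_divisor_q5 assms(2) by blast
qed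

lemma in_class_divisor_p3_sq_q5:
  assumes "x * y = p3 * (p3 * (q5 * t))" "t dvd 1"
  shows "\<exists>a b c e. in_class a b c False e x"
  using maximal_elt_p3 assms(1)
proof (cases rule: maximal_elt_split)
  case (1 x1)
  then obtain a b c e where "in_class a b c False e x1" using in_class_divisor_p3_q5 assms(2) by blast
  from in_class_mult[OF in_class_literals(1) this] show ?thesis using 1 by auto
next
  case (2 y1)
  then show ?thesis using in_class_divisor_p3_q5 assms(2) by blast
qed

lemma in_class_factor_prime:
  assumes "comaximal x y" "x * y = p * z ^ 2" "maximal_elt p"
    and "in_class False False c d e p"
  shows "\<exists>a b c' d' e'. in_class a b c' d' e' x \<and> (c' \<longrightarrow> c) \<and> (d' \<longrightarrow> d) \<and> (e' \<longrightarrow> e)"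
  using assms(3,2)
proof (cases rule: maximal_elt_split)
  case (1 x1)
  have "comaximal x1 y" using comaximal_dvd[OF assms(1)] 1(1) by simp
  then obtain a b where "in_class a b False False False x1"
    using coprime_square_factor[of x1 y 1 z] 1(2) by auto
  from in_class_mult[OF assms(4) this] have "in_class a b c d e x" using 1(1) by simp
  then show ?thesis by blast
next
  case (2 y1)
  have "comaximal x y1" using comaximal_dvd[OF assms(1)] 2(1) by simp
  then obtain a b where "in_class a b False False False x"
    using coprime_square_factor[of x y1 1 z] 2(2) by auto
  then show ?thesis by blast
qed

lemma in_class_factor_p3_prime:
  assumes "comaximal x y" "x * y = p3 * (p * z ^ 2)" "maximal_elt p"
    and "in_class False False False d e p"
  shows "\<exists>a b c' d' e'. in_class a b c' d' e' x \<and> (d' \<longrightarrow> d) \<and> (e' \<longrightarrow> e)"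
  using maximal_elt_p3 assms(2)
proof (cases rule: maximal_elt_split)
  case (1 x1)
  have "comaximal x1 y" using comaximal_dvd[OF assms(1)] 1(1) by simp
  then obtain a b c' d' e' where "in_class a b c' d' e' x1" "d' \<longrightarrow> d" "e' \<longrightarrow> e"
    using in_class_factor_prime[OF _ 1(2) assms(3,4)] by blast
  with in_class_mult[OF in_class_literals(1) this(1)] show ?thesis using 1(1)
    by (intro exI[of _ a] exI[of _ b] exI[of _ "\<not> c'"] exI[of _ d'] exI[of _ e']) simp
next
  case (2 y1)
  have "comaximal x y1" using comaximal_dvd[OF assms(1)] 2(1) by simp
  then show ?thesis using in_class_factor_prime[OF _ 2(2) assms(3,4)] by blast
qed

lemma in_class_factor_alpha:
  assumes "comaximal x y" "x * y = alpha * r ^ 2"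
  shows "\<exists>a b c e. in_class a b c False e x"
proof -
  have "x * y = p3 * (q5 * (ti * r) ^ 2)" using assms(2) unfolding alpha_eq
    by (simp add: power_mult_distrib mult_ac)
  from in_class_factor_p3_prime[OF assms(1) this maximal_elt_q5 in_class_literals(3)]
  obtain a b c d e where "in_class a b c d e x" "\<not> d" by auto
  then have "in_class a b c False e x" by simp
  then show ?thesis by blast
qed

lemma in_class_factor_beta:
  assumes "comaximal x y" "x * y = beta * r ^ 2"
  shows "\<exists>a b c d. in_class a b c d False x"
proof -
  have "x * y = p3 * (p5 * r ^ 2)" using assms(2) unfolding beta_eq by (simp add: mult_ac)
  from in_class_factor_p3_prime[OF assms(1) this maximal_elt_p5 in_class_literals(2)]
  obtain a b c d e where "in_class a b c d e x" "\<not> e" by auto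
  then have "in_class a b c d False x" by simp
  then show ?thesis by blast
qed

lemma square_dvd_15:
  fixes n m :: int
  assumes "\<bar>n * (n * m)\<bar> = 15"
  shows "\<bar>n\<bar> = 1"
proof -
  have "n ^ 2 dvd 15" using assms by (metis dvd_abs_iff dvd_triv_left mult.assoc power2_eq_square)
  then have "n ^ 2 \<le> 15" by (rule zdvd_imp_le) simp
  then have "n ^ 2 < 4 ^ 2" by simp
  then have "\<bar>n\<bar> < 4" using power2_less_imp_less[of "\<bar>n\<bar>" 4] by simp
  moreover have "n \<noteq> 0" using assms by auto
  moreover have "n ^ 2 \<noteq> 4" "n ^ 2 \<noteq> 9" using \<open>n ^ 2 dvd 15\<close> by auto
  ultimately have "n \<in> {-3, -2, -1, 1, 2, 3}" by auto
  then show ?thesis using \<open>n ^ 2 \<noteq> 4\<close> \<open>n ^ 2 \<noteq> 9\<close> by auto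
qed

text \<open>A common divisor \<open>g\<close> of \<open>u\<close> and \<open>s\<close> is comaximal
  to \<open>2 * r\<close>, so \<open>g ^ 2\<close> divides \<open>x\<close>. The norm of
  \<open>x\<close> is squarefree, which makes \<open>g\<close> a unit.\<close>

lemma comaximal_halves:
  assumes "comaximal s (2 * r)" "u * (u + s) = x * r ^ 2" "\<bar>nrm x\<bar> = 15" "s \<noteq> 0"
  shows "comaximal u (u + s)"
proof -
  obtain g u0 s0 where g: "g \<noteq> 0" "u = g * u0" "s = g * s0" "comaximal u0 s0"
    using zt_gcd[of u s] assms(4) by blast
  obtain a b where ab: "a * s + b * (2 * r) ^ 2 = 1"
    using comaximal_power[OF assms(1), of 1 2] unfolding comaximal_def by auto
  have "x = x * (a * s + b * (2 * r) ^ 2)" using ab by simp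
  also have "\<dots> = x * a * s + 4 * b * (x * r ^ 2)" by (simp add: power_mult_distrib algebra_simps)
  also have "\<dots> = g * (x * a * s0 + 4 * b * (u0 * (u + s)))"
    unfolding assms(2)[symmetric] by (simp add: g algebra_simps)
  finally obtain x0 where x0: "x = g * x0" by blast
  have "g * (x0 * (2 * r) ^ 2) = g * (g * (4 * (u0 * (u0 + s0))))"
    using assms(2) unfolding x0 g(2,3) by algebra
  then have "x0 * (2 * r) ^ 2 = g * (4 * (u0 * (u0 + s0)))"
    using g(1) mult_left_cancel by blast
  then have "g dvd (2 * r) ^ 2 * x0" by (metis dvd_triv_left mult.commute)
  moreover have "comaximal g ((2 * r) ^ 2)"
    using comaximal_power[OF assms(1), of 1 2] by (rule comaximal_dvd[OF _ _ dvd_refl]) (simp add: g)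
  ultimately have "g dvd x0" using comaximal_dvd_mult by blast
  then obtain x1 where x1: "x = g * (g * x1)" using x0 by (auto elim: dvdE)
  have "\<bar>nrm g\<bar> = 1" using assms(3) unfolding x1 nrm_mult by (rule square_dvd_15)
  then have "g dvd 1" using unit_nrm by blast
  then have "comaximal (g * u0) s0" using comaximal_mult[OF unit_comaximal g(4)] by blast
  then have "comaximal (g * s0) (g * u0)"
    using comaximal_mult[OF unit_comaximal comaximal_sym] \<open>g dvd 1\<close> by blast
  then have "comaximal (g * u0) (g * s0)" by (rule comaximal_sym)
  then obtain a b where "a * u + b * s = 1" unfolding g comaximal_def by blast
  then have "(a - b) * u + b * (u + s) = 1" by algebra
  then show ?thesis by (rule copI)
qed

subsection \<open>The second descent\<close>

lemma nonresidue_mod_5: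
  fixes k f g :: int
  assumes "5 dvd k * f ^ 2 - g ^ 2" "k mod 5 = 2 \<or> k mod 5 = 3"
  shows "5 dvd g" "5 dvd f"
proof -
  have *: "c = 0 \<and> b = 0"
    if "a = 2 \<or> a = 3" "b \<in> {0, 1, 2, 3, 4}" "c \<in> {0, 1, 2, 3, 4}" "(a * b ^ 2 - c ^ 2) mod 5 = 0"
    for a b c :: int
    using that by auto
  have range: "x mod 5 \<in> {0, 1, 2, 3, 4}" for x :: int
    using pos_mod_bound[of 5 x] pos_mod_sign[of 5 x] by auto
  have "(k mod 5 * (f mod 5) ^ 2 - (g mod 5) ^ 2) mod 5 = (k * f ^ 2 - g ^ 2) mod 5"
    by (intro mod_diff_cong mod_mult_cong) (simp_all add: power_mod)
  also have "\<dots> = 0" using assms(1) by simp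
  finally have "g mod 5 = 0 \<and> f mod 5 = 0" by (rule *[OF assms(2) range range])
  then show "5 dvd g" "5 dvd f" by auto
qed

lemma chi_mult_mod_5:
  assumes "t \<in> {1, 2}"
  shows "chi t (x * y) mod 5 = chi t x * chi t y mod 5"
proof -
  have "5 dvd t ^ 3 + 3 * t + 1" using assms by auto
  then have "5 dvd chi t (x * y) - chi t x * chi t y" using chi_mult dvd_trans by blast
  then show ?thesis by (simp add: mod_eq_dvd_iff)
qed

lemma chi_square_mod_5:
  assumes "t \<in> {1, 2}" "x = k * w ^ 2"
  shows "5 dvd chi t k * chi t w ^ 2 - chi t x"
proof -
  have "chi t x mod 5 = chi t k * chi t w ^ 2 mod 5"
    unfolding assms(2) power2_eq_square chi_mult_mod_5[OF assms(1)]
    by (metis chi_mult_mod_5[OF assms(1)] mod_mult_right_eq)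
  then show ?thesis by (metis mod_eq_dvd_iff)
qed

text \<open>Modulo \<open>p5\<close> the units \<open>- 1\<close> and \<open>th\<close> are squares,
  while \<open>p3\<close> and \<open>q5\<close> become the nonresidues 2 and 3.\<close>

lemma chi1_class_rep: "c \<noteq> e \<Longrightarrow> chi 1 (class_rep a b c False e) mod 5 \<in> {2, 3}"
  by (cases a; cases b; cases c; cases e)
      (simp_all add: class_rep_def zt_literals ZT_mult ZT_arith chi_def one_zt_def)

lemma rl_p3_q5: "0 < rl p3" "0 < rl q5" "0 < rl p5" "rl th < 0"
  using rt_bounds by (simp_all add: p3_def p5_def q5_def)

lemma rl_class_rep_pos: "0 < rl (class_rep a b c False e) \<Longrightarrow> a = b"
  using rl_p3_q5 by (cases a; cases b; cases c; cases e)
    (simp_all add: class_rep_def zero_less_mult_iff mult_less_0_iff)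

text \<open>Over the field with 8 elements the roots of \<open>v^2 + v = th\<close> are
  \<open>th^2\<close> and \<open>th^2 + 1\<close>; each lifts uniquely to a root modulo 4.\<close>

lemma as_solutions_mod_4:
  assumes "a \<in> {0..<4}" "b \<in> {0..<4}" "c \<in> {0..<4}" "4 dvd ZT a b c ^ 2 + ZT a b c - th"
  shows "(a, b, c) \<in> {(0, 2, 3), (3, 2, 1)}"
  using assms unfolding set_lt_4 power2_eq_square zt_literals ZT_mult ZT_arith numeral_dvd_iff zt.sel
  by (elim insertE emptyE; hypsubst; simp)

lemma no_class_mod_4:
  assumes "(a, b, c) \<in> {(0, 2, 3), (3, 2, 1)}"
  shows "\<not> 4 dvd (p3 * (th * p5 - ZT a b c)) ^ 7 - class_rep p p q False q ^ 7"
proof -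
  consider "(a, b, c) = (0, 2, 3)" | "(a, b, c) = (3, 2, 1)" using assms by blast
  then show ?thesis
    by cases (cases p; cases q;
      simp add: class_rep_def zt_literals ZT_mult ZT_arith ZT_seventh Let_def numeral_dvd_iff)+
qed

text \<open>Modulo \<open>p5\<close> the forms are the squares of \<open>m + 2 * n\<close> and
  \<open>m - 2 * n\<close>. If \<open>c\<close> and \<open>e\<close> differed, the representative
  would be a nonresidue, both squares would vanish, and \<open>p5\<close> would divide
  \<open>m\<close> and \<open>n\<close>.\<close>

lemma conic_forms_p5:
  assumes "comaximal m n"
    and f1: "m ^ 2 - th * m * n - th ^ 3 * n ^ 2 = class_rep p q c False e * f1 ^ 2"
    and f2: "m ^ 2 + m * n - th * n ^ 2 = class_rep p q c False e * f2 ^ 2"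
  shows "c = e"
proof (rule ccontr)
  assume "c \<noteq> e"
  define k where "k = chi 1 (class_rep p q c False e)"
  have res: "k mod 5 = 2 \<or> k mod 5 = 3" using chi1_class_rep[OF \<open>c \<noteq> e\<close>] unfolding k_def by auto
  have p5_chi: "5 dvd k * chi 1 f ^ 2 - chi 1 y ^ 2"
    if "x - y ^ 2 = p5 * v" "x = class_rep p q c False e * f ^ 2" for x y v f
  proof -
    have "chi 1 p5 = 0" by (simp add: chi_def p5_def th_def)
    then have "chi 1 (p5 * v) mod 5 = 0" by (simp add: chi_mult_mod_5)
    then have 1: "5 dvd chi 1 x - chi 1 (y ^ 2)" unfolding that(1)[symmetric] by auto
    have 2: "5 dvd chi 1 (y ^ 2) - chi 1 y ^ 2"
      using chi_mult_mod_5[of 1 y y] by (simp add: power2_eq_square mod_eq_dvd_iff)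
    have 3: "5 dvd k * chi 1 f ^ 2 - chi 1 x"
      unfolding k_def by (rule chi_square_mod_5[OF _ that(2)]) simp
    show ?thesis using dvd_add[OF 3 dvd_add[OF 1 2]] by simp
  qed
  have chi_lin: "chi 1 (m + 2 * n) = chi 1 m + 2 * chi 1 n" "chi 1 (m - 2 * n) = chi 1 m - 2 * chi 1 n"
    by (simp_all add: chi_def zt_coeffs_mult algebra_simps)
  \<comment> \<open>The cofactor \<open>6 - 3 * p5 + p5 ^ 2\<close> is
    \<open>5 / p5\<close>.\<close>
  have "m ^ 2 - th * m * n - th ^ 3 * n ^ 2 - (m + 2 * n) ^ 2
      = p5 * (- (6 - 3 * p5 + p5 ^ 2) * (m * n) + m * n - 3 * n ^ 2)"
    using th_cube unfolding p5_def by algebra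
  from nonresidue_mod_5(1)[OF p5_chi[OF this f1] res]
  have 1: "5 dvd chi 1 m + 2 * chi 1 n" unfolding chi_lin .
  have "m ^ 2 + m * n - th * n ^ 2 - (m - 2 * n) ^ 2
      = p5 * ((6 - 3 * p5 + p5 ^ 2) * (m * n - n ^ 2) + n ^ 2)"
    using th_cube unfolding p5_def by algebra
  from nonresidue_mod_5(1)[OF p5_chi[OF this f2] res]
  have 2: "5 dvd chi 1 m - 2 * chi 1 n" unfolding chi_lin .
  have "5 dvd chi 1 m" "5 dvd chi 1 n" using 1 2 by presburger+
  then have "p5 dvd m" "p5 dvd n" using p5_dvd by blast+
  then have "comaximal p5 p5" using comaximal_dvd[OF assms(1)] by blast
  then have "p5 dvd 1" using comaximal_dvd_mult[of p5 p5 1] by simp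
  then show False unfolding unit_nrm by (simp add: nrm_literals)
qed

text \<open>
  Modulo 4 the second form leaves two values for \<open>m / n\<close>, and for neither of them is the first form in a
  class \<open>class_rep p p q False q\<close>, which are the classes left by the real place and by \<open>p5\<close>.
\<close>
lemma conic_forms_mod_4:
  assumes n2: "\<not> 2 dvd n" and F2: "4 dvd m ^ 2 + m * n - th * n ^ 2"
    and F1: "4 dvd (m ^ 2 - th * m * n - th ^ 3 * n ^ 2) ^ 7 - class_rep p p q False q ^ 7"
  shows False
proof -
  define F1 F2 where "F1 = m ^ 2 - th * m * n - th ^ 3 * n ^ 2" and "F2 = m ^ 2 + m * n - th * n ^ 2"
  obtain d where d: "n ^ 14 - 1 = 4 * d"
    using fourteenth_power_mod_4[OF n2] by (auto elim: dvdE)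
  \<comment> \<open>\<open>W\<close> represents \<open>m / n\<close> modulo 4.\<close>
  define W where "W = m * n ^ 13"
  have e1: "n ^ 2 * W ^ 2 = m ^ 2 * (n ^ 14) ^ 2" "n ^ 2 * W = m * n * n ^ 14"
    unfolding W_def by algebra+
  have n14: "n ^ 14 = 1 + 4 * d" using d by (simp add: algebra_simps)
  have "(W ^ 2 + W - th) * n ^ 2 = F2 + 4 * (2 * m ^ 2 * d + 4 * m ^ 2 * d ^ 2 + m * n * d)"
    using e1 unfolding F2_def n14 by algebra
  then have dv: "4 dvd (W ^ 2 + W - th) * n ^ 2" using F2 unfolding F2_def[symmetric]
    by (metis dvd_add dvd_triv_left)
  have "\<not> 2 dvd n ^ 2" using n2 by (simp add: two_dvd_power)
  from odd_inverse(2)[OF this dv] have W4: "4 dvd W ^ 2 + W - th" .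
  obtain w0 w1 w2 where w: "w0 \<in> {0..<4::int}" "w1 \<in> {0..<4::int}" "w2 \<in> {0..<4::int}"
    and r: "of_int 4 dvd W - ZT w0 w1 w2"
    by (rule residue[of 4 W]) auto
  define V where "V = ZT w0 w1 w2"
  obtain h where "W - V = 4 * h" using r unfolding V_def by (auto elim: dvdE)
  then have h: "W = V + 4 * h" by (simp add: algebra_simps)
  have "V ^ 2 + V - th = (W ^ 2 + W - th) - 4 * (2 * V * h + 4 * h ^ 2 + h)"
    unfolding h by algebra
  then have "4 dvd V ^ 2 + V - th" using W4 by (metis dvd_diff dvd_triv_left)
  then have sol: "(w0, w1, w2) \<in> {(0, 2, 3), (3, 2, 1)}"
    unfolding V_def by (rule as_solutions_mod_4[OF w])
  \<comment> \<open>\<open>F1 - F2 = p3 * n * (th * p5 * n - m)\<close>, so where \<open>F2\<close>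
    vanishes modulo 4 and \<open>m = V * n\<close>, the first form is
    \<open>n ^ 2 * G\<close>.\<close>
  define G where "G = p3 * (th * p5 - V)"
  have "F1 - n ^ 2 * G = F2 + 4 * (p3 * (m * n * d) - n ^ 2 * p3 * h)"
    using e1(2) unfolding F1_def F2_def G_def h n14 p3_def p5_def by algebra
  then have "4 dvd F1 - n ^ 2 * G"
    using F2 unfolding F2_def[symmetric] by (metis dvd_add dvd_triv_left)
  from cong_power[OF this, of 7] have "4 dvd F1 ^ 7 - n ^ 14 * G ^ 7"
    by (simp add: power_mult_distrib flip: power_mult)
  moreover have "F1 ^ 7 - n ^ 14 * G ^ 7 = (F1 ^ 7 - G ^ 7) - 4 * (d * G ^ 7)"
    unfolding n14 by (simp add: algebra_simps)
  ultimately have "4 dvd F1 ^ 7 - G ^ 7" by (metis diff_add_cancel dvd_add dvd_triv_left)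
  then have "4 dvd (F1 ^ 7 - class_rep p p q False q ^ 7) - (F1 ^ 7 - G ^ 7)"
    using F1 unfolding F1_def[symmetric] by (rule dvd_diff[rotated])
  then have "4 dvd G ^ 7 - class_rep p p q False q ^ 7" by simp
  then show False using no_class_mod_4[OF sol] unfolding G_def V_def by blast
qed

text \<open>
  The conic passes through \<open>(X, Y, y) = (1, 1, 1 + th)\<close>, which comes from a point of infinite order on the
  elliptic curve; projecting from this point replaces \<open>X\<close> and \<open>Y\<close> by two binary quadratic forms.
\<close>
lemma conic_no_points:
  assumes comaximal: "comaximal X Y" and XY: "X * Y = z ^ 2" and Y4: "4 dvd Y" and X2: "\<not> 2 dvd X"
    and eq: "y ^ 2 = th * beta * (X - th * Y) ^ 2 + 4 * alpha * th ^ 2 * X * Y"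
  shows False
proof -
  have Y2: "2 dvd Y" using Y4 by (rule dvd_trans[rotated]) (simp add: numeral_dvd_iff)
  \<comment> \<open>The line \<open>y = X + th * Y\<close> passes through the known point and meets
    the conic again where \<open>X = th ^ 2 * Y\<close>.\<close>
  have "(y - X - th * Y) * (y + X + th * Y) = 4 * th * (X - Y) * (X - th ^ 2 * Y)"
    using eq th_cube unfolding alpha_def beta_def by algebra
  then have prod: "(y - X - th * Y) * (y + X + th * Y) = 2 * (2 * (th * (X - Y) * (X - th ^ 2 * Y)))"
    by simp
  then have "2 dvd (y - X - th * Y) * (y + X + th * Y)" by (metis dvd_triv_left)
  moreover have "y + X + th * Y = (y - X - th * Y) + 2 * (X + th * Y)" by (simp add: algebra_simps)
  ultimately have "2 dvd y - X - th * Y" unfolding two_prime by (metis dvd_add_left_iff dvd_triv_left)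
  then obtain j where "y - X - th * Y = 2 * j" by (auto elim: dvdE)
  then have j: "y = X + th * Y + 2 * j" by algebra
  have "4 * (j * (j + X + th * Y)) = 4 * (th * (X - Y) * (X - th ^ 2 * Y))"
    using prod unfolding j by algebra
  then have jj: "j * (j + X + th * Y) = th * (X - Y) * (X - th ^ 2 * Y)" by auto
  have XmY: "\<not> 2 dvd X - Y" using X2 Y2 by (metis diff_add_cancel dvd_add)
  then have "X - Y \<noteq> 0" by auto
  \<comment> \<open>\<open>m / n\<close> is the parameter of the projection.\<close>
  then obtain c m n where c: "c \<noteq> 0" "j = c * m" "X - Y = c * n" "comaximal m n"
    using zt_gcd[of j "X - Y"] by blast
  have n2: "\<not> 2 dvd n" using XmY unfolding c(3) two_prime by simp
  have X: "X = Y + c * n" using c(3) by (simp add: algebra_simps)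
  have "c * (m * (j + X + th * Y)) = c * (th * n * (X - th ^ 2 * Y))"
    using jj unfolding c(3) unfolding c(2) by algebra
  then have m1: "m * (j + X + th * Y) = th * n * (X - th ^ 2 * Y)" using c(1) by simp
  \<comment> \<open>The parametrization reads \<open>X : Y = F1 : F2\<close>; the common factor
    \<open>l\<close> of the two forms has to be controlled.\<close>
  define F1 where "F1 = m ^ 2 - th * m * n - th ^ 3 * n ^ 2"
  define F2 where "F2 = m ^ 2 + m * n - th * n ^ 2"
  have "n * j = m * (X - Y)" unfolding c by algebra
  then have XF: "X * F2 = Y * F1" using m1 unfolding F1_def F2_def by algebra
  have "X dvd Y * F1" using XF by (metis dvd_triv_left)
  then have "X dvd F1" using comaximal_dvd_mult comaximal by blast
  then obtain l where l: "F1 = X * l" by (auto elim: dvdE)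
  have X0: "X \<noteq> 0" using X2 by auto
  have "X * F2 = X * (Y * l)" using XF l by (simp add: mult.left_commute)
  then have l2: "F2 = Y * l" using X0 by simp
  \<comment> \<open>This identity and \<open>F2_eq\<close> eliminate \<open>m\<close>: since
    \<open>l\<close> is comaximal to \<open>n\<close>, it divides
    \<open>p3 * p3 * q5 * th\<close>.\<close>
  have F12: "F1 - F2 = p3 * n * (th * p5 * n - m)"
    unfolding F1_def F2_def p3_def p5_def by algebra
  have F2_eq: "p3 * F2 = (m - th * p5 * n) * (p3 * (m + th * p5 * n + n)) - p3 * (th * p3 * q5 * n ^ 2)"
    using th_cube unfolding F2_def p3_def p5_def q5_def by algebra
  obtain a b where "a * m ^ 2 + b * n = 1"
    using comaximal_power[OF c(4), of 2 1] unfolding comaximal_def by auto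
  then have "a * F2 + (b - a * (m - th * n)) * n = 1" unfolding F2_def by algebra
  then have copl: "comaximal l n" unfolding l2 by (metis copI comaximal_dvd dvd_refl dvd_triv_right)
  have "l dvd n * (p3 * (th * p5 * n - m))"
    using F12 unfolding l l2 by (metis dvd_diff dvd_triv_right mult.assoc mult.commute)
  then have d1: "l dvd p3 * (th * p5 * n - m)" using copl comaximal_dvd_mult by blast
  have "n ^ 2 * (p3 * (p3 * (q5 * th))) = - (p3 * (th * p5 * n - m)) * (m + th * p5 * n + n) - p3 * F2"
    unfolding F2_eq by algebra
  moreover have "l dvd p3 * F2" unfolding l2 by simp
  ultimately have "l dvd n ^ 2 * (p3 * (p3 * (q5 * th)))" using d1
    by (metis dvd_diff dvd_minus_iff dvd_mult2)
  moreover have "comaximal l (n ^ 2)" using comaximal_power[OF copl, of 1 2] by simp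
  ultimately have "l dvd p3 * (p3 * (q5 * th))" using comaximal_dvd_mult by blast
  then obtain l' where l': "l * l' = p3 * (p3 * (q5 * th))" by (metis dvdE)
  have "th dvd 1" using th_ti by (metis dvd_triv_left)
  then obtain a1 b1 c1 e1 where kl: "in_class a1 b1 c1 False e1 l"
    using in_class_divisor_p3_sq_q5[OF l'] by blast
  have "\<bar>nrm l * nrm l'\<bar> = 45" unfolding nrm_mult[symmetric] l' by (simp add: nrm_mult nrm_literals)
  then have "odd (nrm l)"
    by (metis even_abs_add_iff even_mult_iff abs_dvd_iff dvd_abs_iff even_numeral odd_numeral)
  then have l_odd: "\<not> 2 dvd l" unfolding two_dvd_iff .
  obtain a2 b2 where kX: "in_class a2 b2 False False False X"
    using coprime_square_factor[OF comaximal, of 1 z] XY by auto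
  have kY: "in_class a2 b2 False False False Y" using in_class_partner[OF kX XY X0] .
  obtain p q where cF: "in_class p q c1 False e1 F1" "in_class p q c1 False e1 F2"
    using in_class_mult[OF kX kl] in_class_mult[OF kY kl] unfolding l l2 by auto
  define k where "k = class_rep p q c1 False e1"
  obtain f1 f2 where f: "F1 = k * f1 ^ 2" "F2 = k * f2 ^ 2" using cF unfolding in_class_def k_def by blast
  have n0: "n \<noteq> 0" using n2 by auto
  \<comment> \<open>Completing the square: the discriminant \<open>th^2 (1 + 4 th)\<close> of
    \<open>F1\<close> is negative at the real place, so \<open>F1\<close> is positive there.\<close>
  have "4 * F1 = (2 * m - th * n) ^ 2 - (th * n) ^ 2 * (1 + 4 * th)"
    unfolding F1_def by algebra
  then have "rl (4 * F1) = rl ((2 * m - th * n) ^ 2 - (th * n) ^ 2 * (1 + 4 * th))" by simp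
  then have "4 * rl F1 = (2 * rl m - rt * rl n) ^ 2 + (rt * rl n) ^ 2 * (- 1 - 4 * rt)"
    unfolding rl_simps rl_mult rl_power rl_th by (simp add: algebra_simps)
  moreover have "0 < (rt * rl n) ^ 2 * (- 1 - 4 * rt)" using n0 rt_bounds by (intro mult_pos_pos) auto
  ultimately have "0 < rl F1" by (smt (verit) zero_le_power2)
  then have "0 < rl k * rl f1 ^ 2" unfolding f by simp
  then have "0 < rl k" by (metis zero_le_power2 zero_less_mult_iff not_less)
  then have pq: "p = q" unfolding k_def by (rule rl_class_rep_pos)
  have ce: "c1 = e1"
    using conic_forms_p5[OF c(4)] f unfolding F1_def F2_def k_def by blast
  have "4 dvd F2" unfolding l2 using Y4 by simp
  moreover have "\<not> 2 dvd F1" unfolding l two_prime using X2 l_odd by simp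
  then have "4 dvd F1 ^ 7 - class_rep p p c1 False c1 ^ 7"
    using in_class_seventh[OF cF(1)] unfolding pq[symmetric] ce by blast
  ultimately show False using conic_forms_mod_4[OF n2] unfolding F1_def F2_def by blast
qed

subsection \<open>The descent on the 2-adic depth\<close>

lemma even_diff_imp_odd: "2 dvd r - k \<Longrightarrow> \<not> 2 dvd k \<Longrightarrow> \<not> (2::zt) dvd r"
  by (metis diff_diff_eq2 add_diff_cancel_left' dvd_diff)

text \<open>Excludes the class \<open>th * beta\<close> for the half of the point. Halving the
  second equation leads at depth 1 to the unsolvable equation over the field with 8 elements, and at
  greater depth to the conic of \<open>conic_no_points\<close>.\<close>

lemma second_descent:
  assumes comaximal: "comaximal k r" and k2: "\<not> 2 dvd k" and r: "r = 2 ^ Suc m * r'" and r': "2 dvd r' - k"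
    and y: "th * beta * k ^ 2 + alpha * r ^ 2 = y ^ 2" and l: "r ^ 2 = th * (l ^ 2 - k ^ 2)"
  shows False
proof -
  define h where "h = 2 ^ m * r'"
  have rh: "r = 2 * h" unfolding r h_def by simp
  have "k ^ 2 + ti * (2 * h) ^ 2 = l ^ 2" using l th_ti unfolding rh by algebra
  from halve[OF this] obtain w where w: "w * (w + k) = ti * h ^ 2" by blast
  show False
  proof (cases m)
    case 0
    obtain a where "r' - k = 2 * a" using r' by (auto elim: dvdE)
    then have a: "h = k + 2 * a" unfolding h_def 0 by (simp add: algebra_simps)
    have ti: "ti = - 3 - th ^ 2" using th_ti th_cube by algebra
    \<comment> \<open>Modulo 2, \<open>h\<close> is \<open>k\<close> and \<open>ti\<close> is
      \<open>1 + th ^ 2\<close>.\<close>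
    have "w ^ 2 + w * k - (1 + th ^ 2) * k ^ 2
        = 2 * (- (2 + th ^ 2) * k ^ 2 - (3 + th ^ 2) * (2 * k * a + 2 * a ^ 2))"
      using w unfolding a ti by algebra
    then have "2 dvd w ^ 2 + w * k - (1 + th ^ 2) * k ^ 2" by simp
    then show False using artin_schreier_unsolvable k2 by blast
  next
    case (Suc m')
    have "2 dvd h" unfolding h_def Suc by simp
    then obtain u where u: "u * (u + k) = ti * h ^ 2" "4 dvd u" using choose_sign[OF w] k2 by blast
    \<comment> \<open>Chosen so that \<open>X * Y\<close> is a square and
      \<open>k = X - th * Y\<close>.\<close>
    define X Y where "X = u + k" and "Y = ti * u"
    have uY: "u = th * Y" unfolding Y_def using th_ti by algebra
    have XY: "X * Y = (ti * h) ^ 2" using u(1) unfolding X_def Y_def by algebra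
    have r2: "r ^ 2 = 4 * th * (u * (u + k))" using u(1) th_ti unfolding rh by algebra
    obtain a b where ab: "a * k + b * r ^ 2 = 1"
      using comaximal_power[OF comaximal, of 1 2] unfolding comaximal_def by auto
    have "a * X + (4 * b * th * (u + k) - a) * th * Y = 1"
      using ab unfolding r2 X_def mult.assoc uY[symmetric] by algebra
    then have "comaximal X Y" by (rule copI)
    moreover have "4 dvd Y" unfolding Y_def using u(2) by simp
    moreover have "\<not> 2 dvd X"
    proof -
      have "(2::zt) dvd 4" by (simp add: numeral_dvd_iff)
      then have "2 dvd u" using u(2) dvd_trans by blast
      then show ?thesis unfolding X_def using k2 by (simp add: dvd_add_right_iff)
    qed
    moreover have "y ^ 2 = th * beta * (X - th * Y) ^ 2 + 4 * alpha * th ^ 2 * X * Y"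
      using y r2 unfolding X_def uY by algebra
    ultimately show False using conic_no_points XY by blast
  qed
qed

lemma in_class_divisor_p3:
  assumes "x * y = p3"
  shows "\<exists>a b c. in_class a b c False False x"
proof -
  have "x * y = p3 * 1" using assms by simp
  with maximal_elt_p3 show ?thesis
  proof (cases rule: maximal_elt_split)
    case (1 x1)
    then obtain a b where "in_class a b False False False x1" using in_class_divisor_unit[of x1 y 1] by auto
    from in_class_mult[OF in_class_literals(1) this] show ?thesis using 1 by auto
  next
    case (2 y1)
    then show ?thesis using in_class_divisor_unit[of x y1 1] by auto
  qed
qed

text \<open>The product of \<open>s + u + v\<close> and \<open>v - u\<close> is
  \<open>(beta - alpha) * r ^ 2 = ti * (p3 * r) ^ 2\<close>. Their gcd \<open>g\<close> divides both
  \<open>s + 2 * u\<close> and \<open>s + 2 * v\<close>, so \<open>g ^ 2\<close> divides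
  \<open>(beta - alpha)\<close> and \<open>g\<close> divides \<open>p3\<close>; the cofactor of
  \<open>g\<close> in \<open>s + u + v\<close> is a unit times a square.\<close>

lemma in_class_midpoint:
  assumes comaximal: "comaximal s (2 * r)" and u: "u * (u + s) = alpha * r ^ 2"
    and v: "v * (v + s) = beta * r ^ 2"
    and t0: "s + u + v \<noteq> 0"
  shows "\<exists>a b c. in_class a b c False False (s + u + v)"
proof -
  define t d where "t = s + u + v" and "d = v - u"
  obtain g t' d' where g: "g \<noteq> 0" "t = g * t'" "d = g * d'" "comaximal t' d'"
    using zt_gcd[of t d] t0 unfolding t_def by blast
  define y z where "y = t' - d'" and "z = t' + d'"
  have "s + 2 * u = t - d" "s + 2 * v = t + d" unfolding t_def d_def by (simp_all add: algebra_simps)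
  then have yz: "s + 2 * u = g * y" "s + 2 * v = g * z"
    unfolding g y_def z_def by (simp_all add: algebra_simps)
  have A: "(g * y) ^ 2 = s ^ 2 + alpha * (2 * r) ^ 2" and B: "(g * z) ^ 2 = s ^ 2 + beta * (2 * r) ^ 2"
    using u v unfolding yz[symmetric] by algebra+
  obtain a b where ab: "a * s ^ 2 + b * (2 * r) ^ 2 = 1"
    using comaximal_power[OF comaximal, of 2 2] unfolding comaximal_def by auto
  have "(beta - alpha) * (a * s ^ 2 + b * (2 * r) ^ 2)
      = g ^ 2 * (a * (beta * y ^ 2 - alpha * z ^ 2) + b * (z ^ 2 - y ^ 2))"
    using A B by algebra
  then have "ti * p3 ^ 2 = g ^ 2 * (a * (beta * y ^ 2 - alpha * z ^ 2) + b * (z ^ 2 - y ^ 2))"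
    unfolding ab beta_alpha by simp
  then have "p3 ^ 2 = g ^ 2 * (th * (a * (beta * y ^ 2 - alpha * z ^ 2) + b * (z ^ 2 - y ^ 2)))"
    using th_ti by algebra
  then have "g ^ 2 dvd p3 ^ 2" by (metis dvd_triv_left)
  then obtain h where h: "p3 = g * h" using sq_dvd_sq by (metis dvdE)
  have "t * d = (beta - alpha) * r ^ 2" using u v unfolding t_def d_def by algebra
  then have "(g * g) * (t' * d') = (g * g) * (ti * (h * r) ^ 2)"
    unfolding beta_alpha h g(2,3) by (simp add: power2_eq_square mult_ac)
  then have "t' * d' = ti * (h * r) ^ 2" using g(1) by simp
  moreover have "ti dvd 1" using th_ti by (metis dvd_triv_right)
  ultimately obtain a b where "in_class a b False False False t'"
    using coprime_square_factor[OF g(4)] by blast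
  moreover obtain a' b' c' where "in_class a' b' c' False False g"
    using in_class_divisor_p3[OF h[symmetric]] by blast
  ultimately have "in_class (a' \<noteq> a) (b' \<noteq> b) (c' \<noteq> False) (False \<noteq> False) (False \<noteq> False) t"
    unfolding g(2) by (intro in_class_mult)
  then show ?thesis unfolding t_def by auto
qed

text \<open>Both \<open>\<bar>S\<bar>\<close> and \<open>\<bar>S + 2 * V\<bar>\<close> are less than
  \<open>\<bar>y\<bar>\<close> for \<open>y = S + 2 * U\<close>, so \<open>y + S\<close> and
  \<open>y + z\<close> have the sign of \<open>y\<close>.\<close>

lemma real_sign:
  fixes S U V R a b :: real
  assumes "U * (U + S) = a * R ^ 2" "V * (V + S) = b * R ^ 2" "R \<noteq> 0" "0 < b" "b < a"
  shows "0 < (U + S) * (S + U + V)"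
proof -
  define y z where "y = S + 2 * U" and "z = S + 2 * V"
  have R: "0 < R ^ 2" using assms(3) by simp
  have y: "y ^ 2 = S ^ 2 + 4 * (a * R ^ 2)" and z: "z ^ 2 = S ^ 2 + 4 * (b * R ^ 2)"
    using assms(1,2) unfolding y_def z_def by algebra+
  have ab: "0 < a * R ^ 2" "b * R ^ 2 < a * R ^ 2" using R assms(4,5) by simp_all
  have "\<bar>S\<bar> ^ 2 < \<bar>y\<bar> ^ 2" "\<bar>z\<bar> ^ 2 < \<bar>y\<bar> ^ 2" using ab unfolding power2_abs y z by simp_all
  then have lt: "\<bar>S\<bar> < \<bar>y\<bar>" "\<bar>z\<bar> < \<bar>y\<bar>" by (simp_all add: power2_less_imp_less)
  have eq: "4 * ((U + S) * (S + U + V)) = (y + S) * (y + z)" unfolding y_def z_def by algebra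
  show ?thesis
  proof (cases "0 < y")
    case True
    then have "0 < (y + S) * (y + z)" using lt by (intro mult_pos_pos) linarith+
    then show ?thesis using eq by linarith
  next
    case False
    then have "0 < (y + S) * (y + z)" using lt by (intro mult_neg_neg) linarith+
    then show ?thesis using eq by linarith
  qed
qed

text \<open>\<open>q5\<close> divides \<open>alpha\<close>, so modulo \<open>q5\<close> the equation
  is \<open>c * k ^ 2 = y ^ 2\<close> with a nonresidue \<open>c\<close>. Thus \<open>q5\<close>
  divides \<open>k\<close> and \<open>y\<close>, and, dividing \<open>alpha\<close> only once, also
  \<open>r\<close>.\<close>

lemma nonresidue_class:
  assumes comaximal: "comaximal k r" and eq: "c * k ^ 2 + alpha * r ^ 2 = y ^ 2" and c: "chi 2 c mod 5 = 2"
  shows False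
proof -
  have "chi 2 alpha = 0" by (simp add: chi_def alpha_def th_def)
  then have 1: "5 dvd chi 2 (alpha * r ^ 2)" using chi_mult_mod_5[of 2 alpha "r ^ 2"] by auto
  have 2: "5 dvd chi 2 c * chi 2 k ^ 2 - chi 2 (c * k ^ 2)" by (rule chi_square_mod_5) simp_all
  have 3: "5 dvd chi 2 1 * chi 2 y ^ 2 - chi 2 (y ^ 2)" by (rule chi_square_mod_5) simp_all
  have "chi 2 (y ^ 2) = chi 2 (c * k ^ 2) + chi 2 (alpha * r ^ 2)" unfolding eq[symmetric] by simp
  then have "chi 2 c * chi 2 k ^ 2 - chi 2 y ^ 2 = (chi 2 c * chi 2 k ^ 2 - chi 2 (c * k ^ 2))
      - (chi 2 1 * chi 2 y ^ 2 - chi 2 (y ^ 2)) - chi 2 (alpha * r ^ 2)"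
    by (simp add: chi_def[of 2 1])
  then have "5 dvd chi 2 c * chi 2 k ^ 2 - chi 2 y ^ 2" using 1 2 3 by (metis dvd_diff)
  from nonresidue_mod_5[OF this] c have "q5 dvd k" "q5 dvd y" using q5_dvd by blast+
  then obtain k' y' where ky: "k = q5 * k'" "y = q5 * y'" by (auto elim!: dvdE)
  have "q5 * (p3 * ti ^ 2 * r ^ 2) = q5 * (q5 * (y' ^ 2 - c * k' ^ 2))"
    using eq unfolding ky alpha_eq by algebra
  then have "p3 * ti ^ 2 * r ^ 2 = q5 * (y' ^ 2 - c * k' ^ 2)"
    using nrm_literals(5) by auto
  then have "r * (r * p3) = q5 * (th ^ 2 * (y' ^ 2 - c * k' ^ 2))"
    using th_ti by algebra
  then have d: "q5 dvd r * (r * p3)" by (metis dvd_triv_left)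
  have npp: "\<not> q5 dvd p3"
  proof
    assume "q5 dvd p3"
    then have "nrm q5 dvd nrm p3" by (metis dvdE dvd_triv_left nrm_mult)
    then show False by (simp add: nrm_literals)
  qed
  have "q5 dvd r"
  proof (rule ccontr)
    assume "\<not> q5 dvd r"
    then have "comaximal q5 r" using maximal_elt_q5 unfolding maximal_elt_def by blast
    then show False using comaximal_dvd_mult d npp by blast
  qed
  then have "comaximal q5 q5" using comaximal_dvd[OF comaximal] ky(1) by simp
  then have "q5 dvd 1" using comaximal_dvd_mult[of q5 q5 1] by simp
  then show False unfolding unit_nrm by (simp add: nrm_literals)
qed

text \<open>
  In the induction step the half of the point \<open>X = s^2 / r^2\<close> is the point with \<open>x = P Q / r0^2\<close>,
  \<open>x + alpha = P T / r0^2\<close> and \<open>x + beta = Q T / r0^2\<close>.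
\<close>
lemma descent:
  assumes "comaximal s r" "\<not> 2 dvd s" "r = 2 ^ Suc n * r'" "2 dvd r' - s"
    and "s ^ 2 + alpha * r ^ 2 = y1 ^ 2" "s ^ 2 + beta * r ^ 2 = y2 ^ 2"
  shows False
  using assms
proof (induction n arbitrary: s r r' y1 y2)
  case 0
  have "s ^ 2 + beta * (2 * r') ^ 2 = y2 ^ 2" using 0 by simp
  from halve[OF this] obtain u where u: "u * (u + s) = beta * r' ^ 2" by blast
  obtain a where "r' - s = 2 * a" using 0 by (auto elim: dvdE)
  then have a: "r' = s + 2 * a" by (simp add: algebra_simps)
  \<comment> \<open>Modulo 2, \<open>r'\<close> is \<open>s\<close> and \<open>beta\<close> is
    \<open>1 + th ^ 2\<close>.\<close>
  have "u ^ 2 + u * s - (1 + th ^ 2) * s ^ 2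
      = 2 * (- (th ^ 2) * s ^ 2 + (1 - th ^ 2) * (2 * a * s + 2 * a ^ 2))"
    using u unfolding a beta_def by algebra
  then have "2 dvd u ^ 2 + u * s - (1 + th ^ 2) * s ^ 2" by simp
  then show False using artin_schreier_unsolvable 0 by blast
next
  case (Suc m)
  define r0 where "r0 = 2 ^ Suc m * r'"
  have r: "r = 2 * r0" using Suc.prems(3) unfolding r0_def by simp
  have s2: "\<not> 2 dvd s" and s0: "s \<noteq> 0" using Suc.prems(2) by auto
  have r'2: "\<not> 2 dvd r'" using even_diff_imp_odd Suc.prems(2,4) by blast
  have r0_ev: "2 dvd r0" unfolding r0_def by simp
  have r0_nz: "r0 \<noteq> 0" unfolding r0_def using r'2 by auto
  obtain u where u: "u * (u + s) = alpha * r0 ^ 2" "4 dvd u"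
    using halve[OF Suc.prems(5)[unfolded r]] choose_sign[OF _ r0_ev s2] by blast
  obtain v where v: "v * (v + s) = beta * r0 ^ 2" "4 dvd v"
    using halve[OF Suc.prems(6)[unfolded r]] choose_sign[OF _ r0_ev s2] by blast
  obtain u' v' where uv': "u = 4 * u'" "v = 4 * v'" using u(2) v(2) by (auto elim!: dvdE)
  \<comment> \<open>Since 4 divides \<open>u\<close> and \<open>v\<close>, all three are
    \<open>s\<close> modulo 4, and their pairwise products are \<open>s ^ 2\<close>.\<close>
  define P Q T where "P = u + s" and "Q = v + s" and "T = s + u + v"
  have cop2: "comaximal s (2 * r0)" using Suc.prems(1) unfolding r .
  have "comaximal P u" unfolding P_def using comaximal_halves[OF cop2 u(1) _ s0] comaximal_sym
    by (simp add: nrm_literals)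
  moreover have "P * u = alpha * r0 ^ 2" using u(1) unfolding P_def by (simp add: mult.commute)
  ultimately obtain a1 b1 c1 e1 where P: "in_class a1 b1 c1 False e1 P" using in_class_factor_alpha by blast
  have "comaximal Q v" unfolding Q_def using comaximal_halves[OF cop2 v(1) _ s0] comaximal_sym
    by (simp add: nrm_literals)
  moreover have "Q * v = beta * r0 ^ 2" using v(1) unfolding Q_def by (simp add: mult.commute)
  ultimately obtain a2 b2 c2 d2 where Q: "in_class a2 b2 c2 d2 False Q" using in_class_factor_beta by blast
  have "0 < (rl u + rl s) * (rl s + rl u + rl v)"
  proof (rule real_sign)
    show "rl u * (rl u + rl s) = (2 - rt) * rl r0 ^ 2"
      using arg_cong[OF u(1), of rl] by (simp add: alpha_def)
    show "rl v * (rl v + rl s) = (1 - rt ^ 2) * rl r0 ^ 2"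
      using arg_cong[OF v(1), of rl] by (simp add: beta_def)
  qed (use r0_nz rt_bounds rt_sq_bounds in simp_all)
  then have PT_pos: "0 < rl (P * T)" unfolding P_def T_def by simp
  then have "T \<noteq> 0" by auto
  then obtain a3 b3 c3 where T: "in_class a3 b3 c3 False False T"
    using in_class_midpoint[OF cop2 u(1) v(1)] unfolding T_def by blast
  have PT: "in_class (a1 \<noteq> a3) (b1 \<noteq> b3) (c1 \<noteq> c3) False e1 (P * T)" using in_class_mult[OF P T] by simp
  have "P * T - s ^ 2 = 4 * (s * (2 * u' + v') + 4 * u' * (u' + v'))"
    unfolding P_def T_def uv' by algebra
  then have "4 dvd P * T - s ^ 2" by (metis dvd_triv_left)
  \<comment> \<open>The classes \<open>1\<close> and \<open>- p3\<close> remain for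
    \<open>P * T\<close>; the sign at the real place then excludes \<open>- p3\<close>.\<close>
  from in_class_mod_4[OF PT this s2]
  have "\<not> e1 \<and> b1 = b3 \<and> (a1 \<noteq> a3 \<longleftrightarrow> c1 \<noteq> c3)" unfolding class_rep_seventh by auto
  moreover have "\<not> (a1 \<noteq> a3 \<and> b1 = b3 \<and> c1 \<noteq> c3 \<and> \<not> e1)"
  proof
    assume "a1 \<noteq> a3 \<and> b1 = b3 \<and> c1 \<noteq> c3 \<and> \<not> e1"
    then obtain w where "P * T = - p3 * w ^ 2" using PT unfolding in_class_def by (auto simp: class_rep_def)
    then have "rl (P * T) = - (rl p3 * rl w ^ 2)" by simp
    moreover have "0 \<le> rl p3 * rl w ^ 2" using rl_p3_q5(1) by simp
    ultimately show False using PT_pos by linarith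
  qed
  ultimately have cls: "\<not> e1" "a1 = a3" "b1 = b3" "c1 = c3" by auto
  obtain y where y: "P * T = y ^ 2" using PT cls unfolding in_class_def by (auto simp: class_rep_def)
  have PQ: "in_class (a1 \<noteq> a2) (b1 \<noteq> b2) (c1 \<noteq> c2) d2 False (P * Q)" using in_class_mult[OF P Q] cls by simp
  have QT: "in_class (a1 \<noteq> a2) (b1 \<noteq> b2) (c1 \<noteq> c2) d2 False (Q * T)"
    using in_class_mult[OF Q T] cls by (simp add: eq_commute)
  \<comment> \<open>As \<open>P * T\<close> is a square, \<open>P * Q\<close> and
    \<open>Q * T\<close> share one class, the class of the half.\<close>
  define c where "c = class_rep (a1 \<noteq> a2) (b1 \<noteq> b2) (c1 \<noteq> c2) d2 False"
  obtain k where k: "P * Q = c * k ^ 2" using PQ unfolding in_class_def c_def by blast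
  obtain l where l: "Q * T = c * l ^ 2" using QT unfolding in_class_def c_def by blast
  have eqA: "c * k ^ 2 + alpha * r0 ^ 2 = y ^ 2"
    unfolding k[symmetric] y[symmetric] u(1)[symmetric] P_def Q_def T_def by algebra
  have eqB: "c * k ^ 2 + beta * r0 ^ 2 = c * l ^ 2"
    unfolding k[symmetric] l[symmetric] v(1)[symmetric] P_def Q_def T_def by algebra
  have "P * Q - s ^ 2 = 4 * (s * (u' + v') + 4 * u' * v')"
    unfolding P_def Q_def uv' by algebra
  then have PQ4: "4 dvd P * Q - s ^ 2" by (metis dvd_triv_left)
  from in_class_mod_4[OF PQ PQ4 s2] have "4 dvd c ^ 7 - 1" unfolding c_def .
  then have c_cases: "c = 1 \<or> c = th * beta \<or> c = - p3 \<or> c = - (th * p5)"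
    unfolding c_def class_rep_seventh by (auto simp: class_rep_def beta_eq mult_ac)
  obtain g k1 r1 where g: "g \<noteq> 0" "k = g * k1" "r0 = g * r1" "comaximal k1 r1"
    using zt_gcd[of k r0] r0_nz by blast
  have "y ^ 2 = g ^ 2 * (c * k1 ^ 2 + alpha * r1 ^ 2)"
    unfolding eqA[symmetric] g by algebra
  then have "g ^ 2 dvd y ^ 2" by (metis dvd_triv_left)
  then obtain y' where y': "y = g * y'" using sq_dvd_sq by (metis dvdE)
  have "g ^ 2 * (c * k1 ^ 2 + alpha * r1 ^ 2) = g ^ 2 * y' ^ 2"
    using eqA unfolding g y' by algebra
  then have eqA1: "c * k1 ^ 2 + alpha * r1 ^ 2 = y' ^ 2" using g(1) by simp
  \<comment> \<open>The residue at \<open>q5\<close> excludes two of the four classes.\<close>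
  have "chi 2 (- p3) mod 5 = 2" "chi 2 (- (th * p5)) mod 5 = 2"
    by (simp_all add: chi_def zt_literals ZT_mult ZT_arith)
  then have c2: "c = 1 \<or> c = th * beta" using c_cases nonresidue_class[OF g(4) eqA1] by blast
  \<comment> \<open>Both surviving classes are 1 modulo 4, so \<open>k\<close> and \<open>s\<close>
    agree modulo 2: the leading digit is preserved.\<close>
  have "th * beta = 1 + 4 * th" using th_cube unfolding beta_def by algebra
  then have "\<exists>e. c = 1 + 4 * e" using c2 by (metis add.right_neutral mult_zero_right)
  then obtain e where e: "c = 1 + 4 * e" by blast
  have "2 dvd P * Q - s ^ 2" using PQ4 by (rule dvd_trans[rotated]) (simp add: numeral_dvd_iff)
  moreover have "(k - s) * (k + s) = (P * Q - s ^ 2) - 2 * (2 * e * k ^ 2)" unfolding k e by algebra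
  ultimately have "2 dvd (k - s) * (k + s)" by (metis dvd_diff dvd_triv_left)
  moreover have "k + s = (k - s) + 2 * s" by simp
  ultimately have ks: "2 dvd k - s" unfolding two_prime by (metis dvd_add_left_iff dvd_triv_left)
  then have k2: "\<not> 2 dvd k" using even_diff_imp_odd s2 by blast
  have g2: "\<not> 2 dvd g" and k1_2: "\<not> 2 dvd k1" using k2 unfolding g(2) two_prime by simp_all
  have "2 ^ Suc m dvd g * r1" unfolding g(3)[symmetric] r0_def by simp
  then have "2 ^ Suc m dvd r1" using comaximal_dvd_mult[OF odd_inverse(1)[OF g2]] by blast
  then obtain r2 where r2: "r1 = 2 ^ Suc m * r2" by (auto elim: dvdE)
  have "2 ^ Suc m * r' = 2 ^ Suc m * (g * r2)"
    using g(3) unfolding r0_def r2 by (simp only: mult_ac)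
  then have r'g: "r' = g * r2" by simp
  have "g * (r2 - k1) = (r' - s) - (k - s)" unfolding r'g g(2) by (simp add: algebra_simps)
  then have "2 dvd g * (r2 - k1)" using Suc.prems(4) ks by (metis dvd_diff)
  then have rk: "2 dvd r2 - k1" using g2 unfolding two_prime by blast
  \<comment> \<open>The coefficient is \<open>beta / c\<close>.\<close>
  have l_eq: "l ^ 2 = g ^ 2 * (k1 ^ 2 + (if c = 1 then beta else ti) * r1 ^ 2) \<and>
     c * k1 ^ 2 + beta * r1 ^ 2 = c * (k1 ^ 2 + (if c = 1 then beta else ti) * r1 ^ 2)"
  proof (cases "c = 1")
    case True
    then show ?thesis using eqB unfolding g by (simp add: power_mult_distrib algebra_simps)
  next
    case False
    then have c: "c = th * beta" using c2 by blast
    have "beta \<noteq> 0" using nrm_literals(7) by auto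
    have "beta * l ^ 2 = beta * (g ^ 2 * (k1 ^ 2 + ti * r1 ^ 2))"
      using eqB th_ti unfolding c g by algebra
    then have "l ^ 2 = g ^ 2 * (k1 ^ 2 + ti * r1 ^ 2)" using \<open>beta \<noteq> 0\<close> by simp
    moreover have "c * k1 ^ 2 + beta * r1 ^ 2 = c * (k1 ^ 2 + ti * r1 ^ 2)"
      unfolding c using th_ti by algebra
    ultimately show ?thesis using False by simp
  qed
  then have "g ^ 2 dvd l ^ 2" by (metis dvd_triv_left)
  then obtain l' where l': "l = g * l'" using sq_dvd_sq by (metis dvdE)
  have "g ^ 2 * l' ^ 2 = g ^ 2 * (k1 ^ 2 + (if c = 1 then beta else ti) * r1 ^ 2)"
    using l_eq unfolding l' power_mult_distrib by blast
  then have l2: "l' ^ 2 = k1 ^ 2 + (if c = 1 then beta else ti) * r1 ^ 2" using g(1) by simp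
  show False
  proof (cases "c = 1")
    case True
    \<comment> \<open>The trivial class reproduces both equations with depth \<open>Suc m\<close>,
      one less than before.\<close>
    show False
      using Suc.IH[OF g(4) k1_2 r2 rk, of y' l'] eqA1 l2 True by simp
  next
    case False
    then have c: "c = th * beta" using c2 by blast
    have "r1 ^ 2 = th * (l' ^ 2 - k1 ^ 2)" using l2 False th_ti by (simp add: mult.assoc[symmetric])
    then show False
      using second_descent[OF g(4) k1_2 r2 rk] eqA1 unfolding c by blast
  qed
qed

subsection \<open>Points over the integers\<close>

text \<open>Among the four unit classes only the trivial one is a square modulo 4.\<close>

lemma square_of_norm:
  assumes "comaximal x y" "x * y = of_int (w ^ 2)" "4 dvd x - 1"
  shows "\<exists>z. x = z ^ 2"
proof -
  have "x * y = 1 * of_int w ^ 2" using assms(2) by simp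
  from coprime_square_factor[OF assms(1) this dvd_refl]
  obtain a b where ab: "in_class a b False False False x" by blast
  have one: "\<not> (2::zt) dvd 1" by (simp add: numeral_dvd_iff)
  have "4 dvd class_rep a b False False False ^ 7 - 1"
    using in_class_mod_4[OF ab _ one] assms(3) by simp
  then have "\<not> a" "\<not> b" unfolding class_rep_seventh by auto
  then show ?thesis using ab unfolding in_class_def by (auto simp: class_rep_def)
qed

lemma comaximal_p3: "\<not> 3 dvd chi (- 1) x \<Longrightarrow> comaximal p3 x"
proof -
  assume a: "\<not> 3 dvd chi (- 1) x"
  have "\<not> p3 dvd x"
  proof
    assume "p3 dvd x"
    then obtain y where y: "x = p3 * y" by (auto elim: dvdE)
    have "- 3 dvd chi (- 1) (p3 * y) - chi (- 1) p3 * chi (- 1) y" using chi_mult[of "- 1" p3 y] by simp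
    moreover have "chi (- 1) p3 = 0" by (simp add: chi_def p3_def th_def)
    ultimately show False using a unfolding y by simp
  qed
  then show ?thesis using maximal_elt_p3 unfolding maximal_elt_def by blast
qed

lemma comaximal_q5: "\<not> 5 dvd chi 2 x \<Longrightarrow> comaximal q5 x"
proof -
  assume a: "\<not> 5 dvd chi 2 x"
  have "\<not> q5 dvd x"
  proof
    assume "q5 dvd x"
    then obtain y where y: "x = q5 * y" by (auto elim: dvdE)
    have "chi 2 q5 = 5" by (simp add: chi_def zt_literals)
    then have "chi 2 (q5 * y) mod 5 = 0" using chi_mult_mod_5[of 2 q5 y] by simp
    then show False using a unfolding y by auto
  qed
  then show ?thesis using maximal_elt_q5 unfolding maximal_elt_def by blast
qed

lemma comaximal_of_int: "coprime p q \<Longrightarrow> comaximal (of_int p) (of_int q)"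
proof -
  assume "coprime p q"
  then obtain u v where "u * p + v * q = 1" using bezout_int[of p q] by auto
  then have "of_int u * of_int p + of_int v * of_int q = (1 :: zt)"
    by (metis of_int_1 of_int_add of_int_mult)
  then show ?thesis by (rule copI)
qed

text \<open>Applied to a factor \<open>x\<close> of a norm and its cofactor \<open>y\<close>. Modulo
  \<open>x\<close> the cofactor is a multiple of \<open>3 * (th^2 + 1)\<close>, the derivative of
  the minimal polynomial at \<open>th\<close>, which is \<open>p3 ^ 3 * q5\<close> up to a
  unit.\<close>

lemma comaximal_different:
  assumes "comaximal p3 x" "comaximal q5 x" "comaximal r x" "y = b * x + e * (p3 ^ 3 * q5 * r ^ 2)"
      "e dvd 1"
  shows "comaximal x y"
proof -
  have "comaximal (p3 ^ 3 * q5 * r ^ 2) x"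
    using comaximal_mult comaximal_power[OF assms(1), of 3 1] comaximal_power[OF assms(3), of 2 1] assms(2) by simp
  then have "comaximal (e * (p3 ^ 3 * q5 * r ^ 2)) x"
    using comaximal_mult unit_comaximal[OF assms(5)] by blast
  then obtain u v where "u * (e * (p3 ^ 3 * q5 * r ^ 2)) + v * x = 1" unfolding comaximal_def by auto
  then have "(v - u * b) * x + u * y = 1" unfolding assms(4) by algebra
  then show ?thesis by (rule copI)
qed

lemma three_eq: "3 = p3 ^ 3 * ti ^ 2"
  unfolding power2_eq_square power3_eq_cube by (simp add: zt_eq_iff zt_coeffs_mult zt_literals)

lemma th_sq_eq: "th ^ 2 + 1 = - (q5 * ti)" "3 + th ^ 2 = - ti"
  unfolding power2_eq_square by (simp_all add: zt_eq_iff zt_coeffs_mult zt_literals)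

lemma ti_units: "- (ti ^ 3) dvd 1" "ti ^ 4 dvd 1"
proof -
  have "- (ti ^ 3) * - (th ^ 3) = 1" "ti ^ 4 * th ^ 4 = 1"
    using th_ti by (simp_all add: mult.commute flip: power_mult_distrib)
  then show "- (ti ^ 3) dvd 1" "ti ^ 4 dvd 1" by (metis dvd_triv_left)+
qed

text \<open>The cubic form is the norm of \<open>p - q * th\<close>. The conditions at 3 and 5 make
  this element comaximal to its cofactor, and it is 1 modulo 4.\<close>

lemma cubic_norm_square:
  fixes p q y :: int
  assumes "coprime p q" "4 dvd p - 1" "4 dvd q" "p ^ 3 + 3 * p * q ^ 2 + q ^ 3 = y ^ 2"
    and "\<not> 3 dvd p + q" "\<not> 5 dvd p - 2 * q"
  shows "\<exists>z. of_int p - of_int q * th = z ^ 2"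
proof -
  define P Q where "P = (of_int p :: zt)" and "Q = (of_int q :: zt)"
  define x where "x = P - Q * th"
  define x' where "x' = P ^ 2 + P * Q * th + Q ^ 2 * (3 + th ^ 2)"
  have "x * x' = P ^ 3 + 3 * P * Q ^ 2 + Q ^ 3"
    using th_cube unfolding x_def x'_def by algebra
  also have "\<dots> = of_int (p ^ 3 + 3 * p * q ^ 2 + q ^ 3)" unfolding P_def Q_def by simp
  finally have xx: "x * x' = of_int (y ^ 2)" unfolding assms(4) .
  have "chi (- 1) x = p + q" "chi 2 x = p - 2 * q"
    unfolding x_def P_def Q_def by (simp_all add: chi_def zt_coeffs_mult th_def)
  then have "comaximal p3 x" "comaximal q5 x" using comaximal_p3 comaximal_q5 assms(5,6) by metis+
  moreover obtain u v where "u * P + v * Q = 1"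
    using comaximal_of_int[OF assms(1)] unfolding comaximal_def P_def Q_def by blast
  then have "(v + u * th) * Q + u * x = 1" unfolding x_def by algebra
  then have "comaximal Q x" by (rule copI)
  moreover have "x' = (P + 2 * Q * th) * x + - (ti ^ 3) * (p3 ^ 3 * q5 * Q ^ 2)"
  proof -
    have "- (ti ^ 3) * (p3 ^ 3 * q5 * Q ^ 2) = (p3 ^ 3 * ti ^ 2) * (- (q5 * ti)) * Q ^ 2" by algebra
    also have "\<dots> = 3 * (th ^ 2 + 1) * Q ^ 2" unfolding th_sq_eq three_eq[symmetric] ..
    finally show ?thesis unfolding x_def x'_def by algebra
  qed
  ultimately have "comaximal x x'" using comaximal_different ti_units(1) by blast
  moreover have "4 dvd x - 1"
    using assms(2,3) unfolding x_def P_def Q_def numeral_dvd_iff by (simp add: zt_coeffs_mult th_def)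
  ultimately show ?thesis using square_of_norm[OF _ xx] unfolding x_def P_def Q_def by blast
qed

text \<open>The sextic is the norm of \<open>s^2 + beta r^2\<close>. The condition at
  \<open>q5\<close> holds because 3 is a nonresidue modulo 5.\<close>

lemma second_norm_square:
  fixes s r y :: int
  assumes "coprime s r" "odd s" "even r" "\<not> 3 dvd s"
    and "s ^ 6 + 9 * s ^ 4 * r ^ 2 + 24 * s ^ 2 * r ^ 4 + 15 * r ^ 6 = y ^ 2"
  shows "\<exists>z. of_int s ^ 2 + beta * of_int r ^ 2 = z ^ 2"
proof -
  define S R where "S = (of_int s :: zt)" and "R = (of_int r :: zt)"
  define x where "x = S ^ 2 + beta * R ^ 2"
  define x' where "x' = S ^ 4 + (9 - beta) * S ^ 2 * R ^ 2 + (24 - 9 * beta + beta ^ 2) * R ^ 4"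
  have beta: "beta ^ 3 - 9 * beta ^ 2 + 24 * beta - 15 = 0" using th_cube unfolding beta_def by algebra
  have "x * x' = S ^ 6 + 9 * S ^ 4 * R ^ 2 + 24 * S ^ 2 * R ^ 4 + 15 * R ^ 6"
    using beta unfolding x_def x'_def by algebra
  also have "\<dots> = of_int (s ^ 6 + 9 * s ^ 4 * r ^ 2 + 24 * s ^ 2 * r ^ 4 + 15 * r ^ 6)"
    unfolding S_def R_def by simp
  finally have xx: "x * x' = of_int (y ^ 2)" unfolding assms(5) .
  have x_literals: "x = ZT (s ^ 2 + r ^ 2) 0 (- (r ^ 2))"
    unfolding x_def S_def R_def zt_literals of_int_zt power2_eq_square by (simp add: ZT_mult ZT_arith)
  have "chi (- 1) x = s ^ 2" "chi 2 x = s ^ 2 - 3 * r ^ 2" unfolding x_literals by (simp_all add: chi_def)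
  moreover have "\<not> 3 dvd s ^ 2" using assms(4) prime_dvd_power[of "3::int" s 2] by auto
  moreover have "\<not> 5 dvd s ^ 2 - 3 * r ^ 2"
  proof
    assume "5 dvd s ^ 2 - 3 * r ^ 2"
    then have "5 dvd 3 * r ^ 2 - s ^ 2" by (simp add: dvd_diff_commute)
    from nonresidue_mod_5[OF this] have "5 dvd s" "5 dvd r" by simp_all
    then have "5 dvd (1::int)" using assms(1) coprime_common_divisor by blast
    then show False by simp
  qed
  ultimately have "comaximal p3 x" "comaximal q5 x" using comaximal_p3 comaximal_q5 by metis+
  moreover have "comaximal R x"
  proof -
    obtain u v where "u * S ^ 2 + v * R = 1"
      using comaximal_power[OF comaximal_of_int[OF assms(1)], of 2 1]
        unfolding comaximal_def S_def R_def by auto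
    then have "(v - u * beta * R) * R + u * x = 1" unfolding x_def by algebra
    then show ?thesis by (rule copI)
  qed
  then have "comaximal (R ^ 2) x" using comaximal_power[of R x 2 1] by simp
  moreover have "x' = (S ^ 2 + (9 - 2 * beta) * R ^ 2) * x + ti ^ 4 * (p3 ^ 3 * q5 * (R ^ 2) ^ 2)"
  proof -
    have "ti ^ 4 * (p3 ^ 3 * q5 * (R ^ 2) ^ 2)
        = (p3 ^ 3 * ti ^ 2) * ((- (q5 * ti)) * (- ti)) * R ^ 4" by algebra
    also have "\<dots> = 3 * ((th ^ 2 + 1) * (3 + th ^ 2)) * R ^ 4" unfolding th_sq_eq three_eq[symmetric] ..
    finally show ?thesis unfolding x_def x'_def beta_def by algebra
  qed
  ultimately have "comaximal x x'" using comaximal_different ti_units(2) by blast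
  moreover have "4 dvd x - 1"
  proof -
    have "4 dvd r ^ 2" using assms(3) by (auto elim!: evenE simp: power2_eq_square)
    moreover have "4 dvd s ^ 2 - 1"
    proof -
      obtain b where "s = 2 * b + 1" using assms(2) by (auto elim: oddE)
      then have "s ^ 2 - 1 = 4 * (b ^ 2 + b)" by (simp add: power2_eq_square algebra_simps)
      then show ?thesis by simp
    qed
    ultimately have "4 dvd (s ^ 2 - 1) + r ^ 2" by (rule dvd_add[rotated])
    then show ?thesis using \<open>4 dvd r ^ 2\<close> unfolding x_literals numeral_dvd_iff by (simp add: algebra_simps)
  qed
  ultimately show ?thesis using square_of_norm[OF _ xx] unfolding x_def S_def R_def by blast
qed

lemma int_coprime_square:
  fixes a b c :: int
  assumes "coprime a b" "a * b = c ^ 2"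
  obtains x y where "a = x ^ 2" "b = y ^ 2" | x y where "a = - (x ^ 2)" "b = - (y ^ 2)"
proof -
  have "coprime (nat \<bar>a\<bar>) (nat \<bar>b\<bar>)" using assms(1) by (simp add: coprime_int_iff[symmetric])
  moreover have "nat \<bar>a\<bar> * nat \<bar>b\<bar> = nat \<bar>c\<bar> ^ 2"
    using assms(2) by (metis abs_mult nat_abs_mult_distrib nat_power_eq abs_ge_zero power_abs)
  then have "is_nth_power 2 (nat \<bar>a\<bar> * nat \<bar>b\<bar>)" by (metis is_nth_powerI)
  ultimately have "is_nth_power 2 (nat \<bar>a\<bar>)" "is_nth_power 2 (nat \<bar>b\<bar>)"
    using is_nth_power_mult_coprime_nat_iff by blast+
  then obtain x y where "nat \<bar>a\<bar> = x ^ 2" "nat \<bar>b\<bar> = y ^ 2" unfolding is_nth_power_def by auto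
  then have xy: "\<bar>a\<bar> = int x ^ 2" "\<bar>b\<bar> = int y ^ 2" by (metis abs_ge_zero int_nat_eq of_nat_power)+
  have "0 \<le> a * b" unfolding assms(2) by simp
  then consider "0 \<le> a" "0 \<le> b" | "a \<le> 0" "b \<le> 0" by (auto simp: zero_le_mult_iff)
  then show thesis
  proof cases
    case 1
    then show thesis using that(1) xy by (metis abs_of_nonneg)
  next
    case 2
    then have "a = - (int x ^ 2)" "b = - (int y ^ 2)" using xy by linarith+
    then show thesis using that(2) by blast
  qed
qed

text \<open>If 3 divides \<open>p + q\<close>, the cubic is \<open>- 3 q^3\<close> modulo 9; if 5
  divides \<open>p - 2 * q\<close>, it is \<open>15 q^3\<close> modulo 25. A square divisible by the
  prime would then force it into \<open>q\<close> and \<open>p\<close>.\<close>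

lemma cubic_square_residues:
  fixes p q y :: int
  assumes "coprime p q" "p ^ 3 + 3 * p * q ^ 2 + q ^ 3 = y ^ 2"
  shows "\<not> 3 dvd p + q" "\<not> 5 dvd p - 2 * q"
proof -
  show "\<not> 3 dvd p + q"
  proof
    assume "3 dvd p + q"
    then obtain k where "p + q = 3 * k" by (auto elim: dvdE)
    then have p: "p = 3 * k - q" by simp
    have eq: "y ^ 2 = 3 * (9 * k ^ 3 - 9 * k ^ 2 * q + 6 * k * q ^ 2 - q ^ 3)"
      using assms(2) unfolding p by algebra
    then have "3 dvd y ^ 2" by simp
    then have "3 dvd y" using prime_dvd_power[of "3::int"] by auto
    then obtain y' where "y = 3 * y'" by (auto elim: dvdE)
    then have "q ^ 3 = 3 * (3 * k ^ 3 - 3 * k ^ 2 * q + 2 * k * q ^ 2 - y' ^ 2)"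
      using eq by algebra
    then have "3 dvd q ^ 3" by simp
    then have "3 dvd q" using prime_dvd_power[of "3::int"] by auto
    moreover have "3 dvd p" using \<open>3 dvd q\<close> unfolding p by simp
    ultimately have "3 dvd (1::int)" using assms(1) coprime_common_divisor by blast
    then show False by simp
  qed
  show "\<not> 5 dvd p - 2 * q"
  proof
    assume "5 dvd p - 2 * q"
    then obtain k where "p - 2 * q = 5 * k" by (auto elim: dvdE)
    then have p: "p = 2 * q + 5 * k" by simp
    have eq: "y ^ 2 = 5 * (3 * q ^ 3 + 15 * q ^ 2 * k + 30 * q * k ^ 2 + 25 * k ^ 3)"
      using assms(2) unfolding p by algebra
    then have "5 dvd y ^ 2" by simp
    then have "5 dvd y" using prime_dvd_power[of "5::int"] by auto
    then obtain y' where "y = 5 * y'" by (auto elim: dvdE)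
    then have "q ^ 3 = 5 * (2 * (y' ^ 2 - 3 * q ^ 2 * k - 6 * q * k ^ 2 - 5 * k ^ 3) - q ^ 3)"
      using eq by algebra
    then have "5 dvd q ^ 3" by (metis dvd_triv_left)
    then have "5 dvd q" using prime_dvd_power[of "5::int"] by auto
    moreover have "5 dvd p" using \<open>5 dvd q\<close> unfolding p by simp
    ultimately have "5 dvd (1::int)" using assms(1) coprime_common_divisor by blast
    then show False by simp
  qed
qed

lemma odd_square_mod_4: "odd (x::int) \<Longrightarrow> 4 dvd x ^ 2 - 1"
proof -
  assume "odd x"
  then obtain b where "x = 2 * b + 1" by (auto elim: oddE)
  then have "x ^ 2 - 1 = 4 * (b ^ 2 + b)" by (simp add: power2_eq_square algebra_simps)
  then show ?thesis by simp
qed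

lemma cubic_square_mod_4:
  fixes p q y :: int
  assumes "odd p" "4 dvd q" "p ^ 3 + 3 * p * q ^ 2 + q ^ 3 = y ^ 2"
  shows "4 dvd p - 1"
proof -
  have "even q" using assms(2) by presburger
  then have "odd (p ^ 3 + 3 * p * q ^ 2 + q ^ 3)" using assms(1) by simp
  then have "odd y" unfolding assms(3) by simp
  have "4 dvd (y ^ 2 - 1) - p * (p ^ 2 - 1) - q * (3 * p * q + q ^ 2)"
    by (rule dvd_diff[OF dvd_diff[OF odd_square_mod_4[OF \<open>odd y\<close>] dvd_mult[OF odd_square_mod_4[OF assms(1)]]]
      dvd_mult2[OF assms(2)]])
  moreover have "(y ^ 2 - 1) - p * (p ^ 2 - 1) - q * (3 * p * q + q ^ 2) = p - 1"
    using assms(3) by algebra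
  ultimately show ?thesis by simp
qed

lemma coprime_neg_sum:
  fixes a c :: int
  assumes "coprime a c"
  shows "coprime a (- (a + c))" "coprime c (- (a + c))"
proof -
  have "coprime c a" using assms by (simp add: coprime_commute)
  then have "coprime c (c + a)" by (simp add: coprime_iff_gcd_eq_1)
  moreover have "coprime a (a + c)" using assms by (simp add: coprime_iff_gcd_eq_1)
  ultimately show "coprime a (- (a + c))" "coprime c (- (a + c))"
    unfolding coprime_minus_right_iff by (simp_all only: add.commute)
qed

text \<open>\<open>p / q\<close> is the \<open>n\<close>-coordinate of a half of the point \<open>n = - a c / e^2\<close> on \<open>y^2 = n^3 + 3 n + 1\<close>.\<close>
lemma no_small_point:
  fixes p q l m :: int
  assumes "coprime p q" "q \<noteq> 0" "odd p" "even q"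
    and l: "l ^ 2 = q * (p ^ 3 + 3 * p * q ^ 2 + q ^ 3)"
    and m: "m ^ 2 = (p - 2 * q) * (p ^ 3 + 3 * p ^ 2 * q - 5 * q ^ 3)"
  shows False
proof -
  have "coprime q (p ^ 3)" using assms(1) by (simp add: coprime_commute)
  moreover have "p ^ 3 + 3 * p * q ^ 2 + q ^ 3 = p ^ 3 + (3 * p * q + q ^ 2) * q" by algebra
  ultimately have copq: "coprime q (p ^ 3 + 3 * p * q ^ 2 + q ^ 3)"
    by (metis coprime_iff_gcd_eq_1 gcd_add_mult add.commute mult.commute)
  then obtain P Q r u where PQ: "Q = r ^ 2" "P ^ 3 + 3 * P * Q ^ 2 + Q ^ 3 = u ^ 2" "coprime P Q"
      "Q \<noteq> 0" "odd P" "even Q" "m ^ 2 = (P - 2 * Q) * (P ^ 3 + 3 * P ^ 2 * Q - 5 * Q ^ 3)"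
  proof (cases rule: int_coprime_square[OF copq l[symmetric]])
    case (1 x y)
    then show thesis using that[of q x p y] assms by simp
  next
    case (2 x y)
    \<comment> \<open>Both factors are negative; replacing \<open>p\<close>, \<open>q\<close> by
      their negatives makes them positive.\<close>
    have pos: "- q = x ^ 2" "(- p) ^ 3 + 3 * (- p) * (- q) ^ 2 + (- q) ^ 3 = y ^ 2"
      using 2 by algebra+
    have m': "m ^ 2 = (- p - 2 * - q) * ((- p) ^ 3 + 3 * (- p) ^ 2 * - q - 5 * (- q) ^ 3)"
      using m by algebra
    show thesis by (rule that[OF pos _ _ _ _ m']) (use assms(1-4) in simp_all)
  qed
  have r: "even r" "r \<noteq> 0" using PQ(1,4,6) by auto
  then have Q4: "4 dvd Q" unfolding PQ(1) by (auto elim!: evenE simp: power2_eq_square)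
  have P4: "4 dvd P - 1" using cubic_square_mod_4[OF PQ(5) Q4 PQ(2)] .
  note res = cubic_square_residues[OF PQ(3,2)]
  define G where "G = P - 2 * Q"
  define H where "H = P ^ 3 + 3 * P ^ 2 * Q - 5 * Q ^ 3"
  \<comment> \<open>A common divisor of \<open>G\<close> and \<open>H\<close> divides
    \<open>15 * Q ^ 3\<close>, to which \<open>G\<close> is coprime.\<close>
  have H: "H = 3 * 5 * Q ^ 3 + (G ^ 2 + 9 * G * Q + 24 * Q ^ 2) * G" unfolding G_def H_def by algebra
  have P: "P = G + 2 * Q" unfolding G_def by simp
  have GQ: "coprime G Q" using PQ(3) unfolding G_def coprime_iff_gcd_eq_1
    by (metis gcd.commute gcd_add_mult mult_minus_left uminus_add_conv_diff add.commute)
  have "\<not> 3 dvd G"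
  proof
    assume "3 dvd G"
    then have "3 dvd G + 3 * Q" by simp
    then show False using res(1) unfolding P by (simp add: algebra_simps)
  qed
  then have "coprime 3 G" by (simp add: prime_imp_coprime)
  then have G3: "coprime G 3" by (simp only: coprime_commute)
  have "\<not> 5 dvd G" using res(2) unfolding G_def .
  then have "coprime 5 G" by (simp add: prime_imp_coprime)
  then have G5: "coprime G 5" by (simp only: coprime_commute)
  have "coprime G (3 * 5 * Q ^ 3)"
    using G3 G5 GQ by (simp only: coprime_mult_right_iff coprime_power_right_iff simp_thms)
  then have "coprime G H" unfolding H
    by (metis coprime_iff_gcd_eq_1 gcd_add_mult add.commute mult.commute)
  moreover have GH: "G * H = m ^ 2" using PQ(7) unfolding G_def H_def by simp
  moreover have "4 dvd G - 1"
  proof -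
    have "4 dvd (P - 1) - 2 * Q" by (rule dvd_diff[OF P4 dvd_mult[OF Q4]])
    then show ?thesis unfolding G_def by (simp add: algebra_simps)
  qed
  ultimately obtain s w where s: "G = s ^ 2" "H = w ^ 2"
  proof (cases rule: int_coprime_square[OF \<open>coprime G H\<close> GH])
    case (2 x y)
    \<comment> \<open>The negative sign is impossible: \<open>G\<close> is 1 modulo 4, and minus an
      odd square is 3.\<close>
    have "odd G" using PQ(5) unfolding G_def by simp
    then have "4 dvd x ^ 2 - 1" using odd_square_mod_4[of x] 2 by simp
    moreover have "4 dvd - (x ^ 2) - 1" using \<open>4 dvd G - 1\<close> 2 by simp
    ultimately have "4 dvd (x ^ 2 - 1) + (- (x ^ 2) - 1)" by (rule dvd_add)
    then show thesis by simp
  qed (use that in blast)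
  have "odd (s ^ 2)" using PQ(5) unfolding s(1)[symmetric] G_def by simp
  then have s_odd: "odd s" by simp
  have comaximal: "coprime s r" using GQ unfolding s(1) PQ(1) by simp
  have s3: "\<not> 3 dvd s" using \<open>\<not> 3 dvd G\<close> unfolding s(1) by (auto simp: power2_eq_square)
  have h6: "s ^ 6 + 9 * s ^ 4 * r ^ 2 + 24 * s ^ 2 * r ^ 4 + 15 * r ^ 6 = w ^ 2"
    unfolding s(2)[symmetric] H s(1) PQ(1) by algebra
  from second_norm_square[OF comaximal s_odd r(1) s3 h6]
  obtain y2 where y2: "of_int s ^ 2 + beta * of_int r ^ 2 = y2 ^ 2" by blast
  from cubic_norm_square[OF PQ(3) P4 Q4 PQ(2) res]
  obtain y1 where y1: "of_int P - of_int Q * th = y1 ^ 2" by blast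
  have "of_int P - of_int Q * th = of_int s ^ 2 + alpha * of_int r ^ 2"
    unfolding P s(1) PQ(1) alpha_def by (simp add: algebra_simps)
  then have y1': "of_int s ^ 2 + alpha * of_int r ^ 2 = y1 ^ 2" using y1 by simp
  have "\<not> is_unit (2::int)" by simp
  then obtain r' where r': "r = 2 ^ multiplicity 2 r * r'" "odd r'"
    using multiplicity_decompose'[OF r(2), of 2] by blast
  have "multiplicity 2 r \<noteq> 0" using r' r(1) by (metis mult_1 power_0)
  then obtain n where n: "multiplicity 2 r = Suc n" by (cases "multiplicity 2 r") auto
  have "r = 2 ^ Suc n * r'" using r'(1) unfolding n .
  then have r_eq: "of_int r = 2 ^ Suc n * (of_int r' :: zt)" by simp
  have "\<not> 2 dvd (of_int s :: zt)" using s_odd by (simp add: numeral_dvd_iff)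
  moreover have "2 dvd (of_int r' :: zt) - of_int s" using s_odd r'(2) by (simp add: numeral_dvd_iff)
  ultimately show False using descent[OF comaximal_of_int[OF comaximal] _ r_eq _ y1' y2] by blast
qed

text \<open>Because the \<open>th^2\<close> coordinate of \<open>z ^ 2\<close> vanishes,
  \<open>z\<close> is determined by \<open>p / q = z1 / z2\<close> up to a factor: its coordinates
  are \<open>k / 2\<close> times \<open>3 q^2 - p^2\<close>, \<open>2 p q\<close>,
  \<open>2 q^2\<close>. Parity and coprimality force \<open>k\<close> to be 2 or -2.\<close>

lemma halving_coordinates:
  fixes P e :: int
  assumes z: "of_int P - of_int (e ^ 2) * th = z ^ 2" and "coprime P e" "even e" "e \<noteq> 0"
  obtains p q where "coprime p q" "q \<noteq> 0" "e ^ 2 = 4 * (q * (p ^ 3 + 3 * p * q ^ 2 + q ^ 3))"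
    "P = (3 * q ^ 2 - p ^ 2) ^ 2 - 8 * p * q ^ 3"
proof -
  define z0 z1 z2 where "z0 = c0 z" and "z1 = c1 z" and "z2 = c2 z"
  have e0: "P = z0 ^ 2 - 2 * (z1 * z2)"
    and e1: "- (e ^ 2) = 2 * z0 * z1 - 6 * z1 * z2 - z2 ^ 2"
    and e2: "z1 ^ 2 + 2 * z0 * z2 = 3 * z2 ^ 2"
    using arg_cong[OF z, of c0] arg_cong[OF z, of c1] arg_cong[OF z, of c2]
    unfolding z0_def z1_def z2_def by (simp_all add: power2_eq_square zt_coeffs_mult th_def)
  have "z2 \<noteq> 0"
  proof
    assume "z2 = 0"
    then have "z1 = 0" using e2 by simp
    then show False using e1 \<open>z2 = 0\<close> assms(4) by simp
  qed
  define g where "g = gcd z1 z2"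
  have g0: "g \<noteq> 0" using \<open>z2 \<noteq> 0\<close> unfolding g_def by simp
  obtain p q where pq: "z1 = p * g" "z2 = q * g" "coprime p q"
    using gcd_coprime_exists[of z1 z2] g0 unfolding g_def by blast
  have q0: "q \<noteq> 0" using \<open>z2 \<noteq> 0\<close> pq(2) by auto
  have "g * (2 * z0 * q) = g * (g * (3 * q ^ 2 - p ^ 2))" using e2 unfolding pq by algebra
  then have q5: "2 * z0 * q = g * (3 * q ^ 2 - p ^ 2)" using g0 by simp
  then have "g * p ^ 2 = q * (3 * q * g - 2 * z0)" by algebra
  then have "q dvd g * p ^ 2" by (metis dvd_triv_left)
  moreover have "coprime q (p ^ 2)" using pq(3) by (simp add: coprime_commute)
  ultimately have "q dvd g" by (simp add: coprime_dvd_mult_left_iff)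
  then obtain k where k: "g = q * k" by (auto elim: dvdE)
  have "q * (2 * z0) = q * (k * (3 * q ^ 2 - p ^ 2))" using q5 unfolding k by algebra
  then have z0: "2 * z0 = k * (3 * q ^ 2 - p ^ 2)" using q0 by simp
  have e_k: "e ^ 2 = k ^ 2 * (q * (p ^ 3 + 3 * p * q ^ 2 + q ^ 3))"
    using e1 z0 unfolding pq k by algebra
  have "even k"
  proof (rule ccontr)
    assume "odd k"
    moreover have "even (k * (3 * q ^ 2 - p ^ 2))" unfolding z0[symmetric] by simp
    ultimately have "even p \<longleftrightarrow> even q" by simp
    then have "odd p" "odd q" using pq(3) by (metis coprime_common_divisor odd_one)+
    then have "odd (e ^ 2)" unfolding e_k using \<open>odd k\<close> by simp
    then show False using assms(3) by simp
  qed
  then obtain j where j: "k = 2 * j" by (auto elim: evenE)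
  have z0j: "z0 = j * (3 * q ^ 2 - p ^ 2)" using z0 unfolding j by simp
  have Pj: "P = j ^ 2 * ((3 * q ^ 2 - p ^ 2) ^ 2 - 8 * p * q ^ 3)"
    unfolding e0 z0j pq k j by algebra
  have ej: "e ^ 2 = j ^ 2 * (4 * (q * (p ^ 3 + 3 * p * q ^ 2 + q ^ 3)))"
    unfolding e_k j by algebra
  have "coprime P (e ^ 2)" using assms(2) by simp
  moreover have "j ^ 2 dvd P" "j ^ 2 dvd e ^ 2" unfolding Pj ej by simp_all
  ultimately have "is_unit (j ^ 2)" by (rule coprime_common_divisor)
  then have "j ^ 2 = 1" by (simp add: abs_square_eq_1)
  then show thesis using that[OF pq(3) q0] Pj ej by simp
qed

text \<open>\<open>n = - a c / e^2\<close> is a point on an elliptic curve over the rationals. The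
  cubic form in \<open>P\<close> and \<open>e ^ 2\<close> is a square, so \<open>P - e^2 th\<close>
  is a square in \<open>Z[th]\<close> and the point can be halved.\<close>

lemma no_even_point:
  fixes a c e y :: int
  assumes sum: "a + c + e = 0" and "e \<noteq> 0" "coprime a c" "even e"
    and y: "y ^ 2 = (a ^ 2 + a * c + c ^ 2) ^ 3 - 3 * (a * c * e) ^ 2"
  shows False
proof -
  have e: "e = - (a + c)" using sum by simp
  have "even (a + c)" using assms(4) unfolding e by simp
  then have odd: "odd a" "odd c" using assms(3) by (metis coprime_common_divisor even_add odd_one)+
  define P where "P = - (a * c)"
  have "coprime a e" "coprime c e" using coprime_neg_sum[OF assms(3)] unfolding e .
  then have comaximal: "coprime P e" unfolding P_def by simp
  have "odd P" unfolding P_def using odd by simp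
  have "4 dvd e ^ 2" using assms(4) by (auto elim!: evenE simp: power2_eq_square)
  have f: "P ^ 3 + 3 * P * (e ^ 2) ^ 2 + (e ^ 2) ^ 3 = y ^ 2"
    unfolding y P_def e by algebra
  have P4: "4 dvd P - 1" using cubic_square_mod_4[OF \<open>odd P\<close> \<open>4 dvd e ^ 2\<close> f] .
  have cop2: "coprime P (e ^ 2)" using comaximal by simp
  obtain z where "of_int P - of_int (e ^ 2) * th = z ^ 2"
    using cubic_norm_square[OF cop2 P4 \<open>4 dvd e ^ 2\<close> f cubic_square_residues[OF cop2 f]] by blast
  then obtain p q where pq: "coprime p q" "q \<noteq> 0" "e ^ 2 = 4 * (q * (p ^ 3 + 3 * p * q ^ 2 + q ^ 3))"
    "P = (3 * q ^ 2 - p ^ 2) ^ 2 - 8 * p * q ^ 3"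
    using halving_coordinates comaximal assms(2,4) by metis
  obtain l where l: "e = 2 * l" using assms(4) by (auto elim: evenE)
  have l2: "l ^ 2 = q * (p ^ 3 + 3 * p * q ^ 2 + q ^ 3)" using pq(3) unfolding l by simp
  have "even (a - c)" using \<open>even (a + c)\<close> by simp
  \<comment> \<open>With \<open>a = m - l\<close> and \<open>c = - m - l\<close> one has
    \<open>P = m ^ 2 - l ^ 2\<close>, so \<open>m ^ 2\<close> is also a quartic form in
    \<open>p\<close>, \<open>q\<close>.\<close>
  then obtain m where m: "a - c = 2 * m" by (rule evenE)
  have ac: "a = m - l" "c = - m - l" using m e l by simp_all
  have Pml: "P = m ^ 2 - l ^ 2" unfolding P_def ac by algebra
  then have m2: "m ^ 2 = (p - 2 * q) * (p ^ 3 + 3 * p ^ 2 * q - 5 * q ^ 3)"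
    using pq(4) l2 by algebra
  \<comment> \<open>For odd \<open>l\<close>, \<open>m\<close> is even and \<open>P\<close> is 3
    modulo 4.\<close>
  have "even l"
  proof (rule ccontr)
    assume "odd l"
    then have "even m" using \<open>odd P\<close> unfolding Pml by simp
    then have "4 dvd m ^ 2" by (auto elim!: evenE simp: power2_eq_square)
    from dvd_diff[OF dvd_diff[OF this odd_square_mod_4[OF \<open>odd l\<close>]] P4]
    have "4 dvd m ^ 2 - (l ^ 2 - 1) - (P - 1)" .
    then show False unfolding Pml by simp
  qed
  have "even q"
  proof (rule ccontr)
    assume "odd q"
    then have "odd (l ^ 2) \<or> even (p ^ 3 + 3 * p * q ^ 2 + q ^ 3)" unfolding l2 by simp
    then show False using \<open>even l\<close> \<open>odd q\<close> by (cases "even p") auto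
  qed
  moreover have "odd p" using pq(1) \<open>even q\<close> by (metis coprime_common_divisor odd_one)
  ultimately show False using no_small_point[OF pq(1,2) _ _ l2 m2] by blast
qed

text \<open>Given \<open>a + c + e = 0\<close>, the right-hand side is symmetric in the three
  numbers, and one of them is even.\<close>

lemma no_int_point:
  fixes a c e y :: int
  assumes sum: "a + c + e = 0" and nz: "a \<noteq> 0" "c \<noteq> 0" "e \<noteq> 0" and comaximal: "coprime a c"
    and y: "y ^ 2 = (a ^ 2 + a * c + c ^ 2) ^ 3 - 3 * (a * c * e) ^ 2"
  shows False
proof -
  have e: "e = - (a + c)" using sum by simp
  have cops: "coprime a e" "coprime c e" using coprime_neg_sum[OF comaximal] unfolding e .
  have "even e \<or> even a \<or> even c" using sum by presburger
  then consider "even e" | "even a" | "even c" by blast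
  then show False
  proof cases
    case 1
    then show False using no_even_point[OF sum nz(3) comaximal _ y] by blast
  next
    case 2
    have "y ^ 2 = (c ^ 2 + c * e + e ^ 2) ^ 3 - 3 * (c * e * a) ^ 2" unfolding y e by algebra
    then show False using no_even_point[of c e a] 2 sum nz cops by (simp add: add_ac)
  next
    case 3
    have "y ^ 2 = (a ^ 2 + a * e + e ^ 2) ^ 3 - 3 * (a * e * c) ^ 2" unfolding y e by algebra
    then show False using no_even_point[of a e c] 3 sum nz cops by (simp add: add_ac)
  qed
qed

section \<open>Rational points and products of three quadratics\<close>

lemma rat_square_int:
  fixes y :: rat
  assumes "y ^ 2 = of_int n"
  obtains m where "y = of_int m"
proof -
  obtain p q where pq: "y = of_int p / of_int q" "q > 0" "coprime p q"
    by (metis Fract_of_int_quotient Rat_cases)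
  have "of_int (p ^ 2) = (of_int (n * q ^ 2) :: rat)"
    using assms pq(2) unfolding pq(1) by (simp add: power_divide field_simps)
  then have "p ^ 2 = n * q ^ 2" by (simp only: of_int_eq_iff)
  then have "q ^ 2 dvd p ^ 2" by simp
  then have "q dvd p" by (simp add: pow_divides_pow_iff)
  then have "is_unit q" using pq(3) by (metis coprime_common_divisor dvd_refl)
  then have "q = 1" using pq(2) by simp
  then show thesis using that[of p] pq(1) by simp
qed

text \<open>The equation is homogeneous with weight 1 for \<open>a\<close>, \<open>c\<close>,
  \<open>e\<close> and weight 3 for \<open>y\<close>.\<close>

lemma no_rat_point:
  fixes a c e y :: rat
  assumes sum: "a + c + e = 0" and nz: "a \<noteq> 0" "c \<noteq> 0" "e \<noteq> 0"
    and y: "y ^ 2 = (a ^ 2 + a * c + c ^ 2) ^ 3 - 3 * (a * c * e) ^ 2"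
  shows False
proof -
  obtain p q where pq: "a / c = of_int p / of_int q" "q > 0" "coprime p q"
    by (metis Fract_of_int_quotient Rat_cases)
  define k where "k = c / of_int q"
  have k0: "k \<noteq> 0" unfolding k_def using nz pq(2) by simp
  have c: "c = k * of_int q" unfolding k_def using pq(2) by simp
  have "a = (a / c) * c" using nz by simp
  also have "\<dots> = k * of_int p" unfolding pq(1) k_def by simp
  finally have a: "a = k * of_int p" .
  define r where "r = - (p + q)"
  have "e = - (a + c)" using sum by (simp add: eq_neg_iff_add_eq_0 add.commute add.left_commute)
  then have e: "e = k * of_int r" unfolding a c r_def by (simp add: algebra_simps)
  define n where "n = (p ^ 2 + p * q + q ^ 2) ^ 3 - 3 * (p * q * r) ^ 2"
  have "y ^ 2 = k ^ 6 * of_int n" unfolding y a c e n_def by simp algebra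
  then have "(y / k ^ 3) ^ 2 = of_int n" using k0 by (simp add: power_divide flip: power_mult)
  then obtain m where "y / k ^ 3 = of_int m" by (rule rat_square_int)
  then have "of_int (m ^ 2) = (of_int n :: rat)" using \<open>(y / k ^ 3) ^ 2 = of_int n\<close> by simp
  then have "m ^ 2 = n" by (simp only: of_int_eq_iff)
  moreover have "p \<noteq> 0" "q \<noteq> 0" "r \<noteq> 0" using nz a c e by auto
  ultimately show False using no_int_point[of p q r m] pq(3) unfolding n_def r_def by simp
qed

text \<open>The hypotheses are the vanishing coefficients of degrees 5 to 2, and the conclusion
  concerns the coefficient of degree 1.\<close>

lemma quadratic_factors:
  fixes a b c d e f :: rat
  assumes x5: "a + c + e = 0"
    and x4: "b + d + f + a * c + a * e + c * e = 0"
    and x3: "a * c * e + a * (d + f) + c * (b + f) + e * (b + d) = 0"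
    and x2: "b * d + b * f + d * f + a * c * f + a * e * d + c * e * b = 0"
  shows "a * d * f + c * b * f + e * b * d = 0"
proof (cases "a = 0 \<or> c = 0 \<or> e = 0")
  case True
  then show ?thesis
  proof (elim disjE)
    assume "a = 0"
    then have "e = - c" "c * (f - d) = 0" using x5 x3 by algebra+
    then show ?thesis using \<open>a = 0\<close> by algebra
  next
    assume "c = 0"
    then have "e = - a" "a * (f - b) = 0" using x5 x3 by algebra+
    then show ?thesis using \<open>c = 0\<close> by algebra
  next
    assume "e = 0"
    then have "c = - a" "a * (d - b) = 0" using x5 x3 by algebra+
    then show ?thesis using \<open>e = 0\<close> by algebra
  qed
next
  case False
  \<comment> \<open>The coefficients of degrees 4 and 3 make \<open>b\<close>, \<open>d\<close>,
    \<open>f\<close> linear in \<open>u\<close>. That of degree 2 becomes a quadratic in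
    \<open>u\<close>, whose discriminant is 36 times the right-hand side of the curve.\<close>
  define u where "u = - (a - c) - 3 * (b - d) / e"
  define s where "s = a ^ 2 + a * c + c ^ 2"
  define v where "v = - ((a - c) * (c - e) * (e - a))"
  have e: "e = - (a + c)" using x5 by algebra
  have bd: "3 * (b - d) = - e * (a - c) - e * u" unfolding u_def using False by (simp add: field_simps)
  have "e * (9 * d - (3 * c ^ 2 + s + u * (e - a))) = 0"
    using x5 x4 x3 bd unfolding s_def by algebra
  then have d: "9 * d = 3 * c ^ 2 + s + u * (e - a)" using False by simp
  have b: "9 * b = 3 * a ^ 2 + s + u * (c - e)" using d bd unfolding s_def e by algebra
  have f: "9 * f = 3 * e ^ 2 + s + u * (a - c)" using d b x4 unfolding s_def e by algebra
  have "81 * (b * d + b * f + d * f + a * c * f + a * e * d + c * e * b) = 3 * (5 * s ^ 2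
      + 2 * v * u - s * u ^ 2)"
    using b d f unfolding s_def v_def e by algebra
  then have quad: "5 * s ^ 2 + 2 * v * u - s * u ^ 2 = 0" unfolding x2 by simp
  have "((v - s * u) / 3) ^ 2 = (a ^ 2 + a * c + c ^ 2) ^ 3 - 3 * (a * c * e) ^ 2"
  proof -
    \<comment> \<open>\<open>v ^ 2\<close> is the discriminant of the cubic with roots
      \<open>a\<close>, \<open>c\<close>, \<open>e\<close>.\<close>
    have "v ^ 2 = 4 * s ^ 3 - 27 * (a * c * e) ^ 2" unfolding v_def s_def e by algebra
    then have "(v - s * u) ^ 2 = 9 * (s ^ 3 - 3 * (a * c * e) ^ 2)" using quad by algebra
    then show ?thesis unfolding s_def by (simp add: power_divide)
  qed
  then show ?thesis using no_rat_point[OF x5] False by blast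
qed

lemma degree_2_monic:
  fixes g :: "rat poly"
  assumes "degree g = 2"
  obtains k a b where "k \<noteq> 0" "g = smult k [:b, a, 1:]"
proof -
  define k where "k = coeff g 2"
  have k0: "k \<noteq> 0" using assms unfolding k_def by (metis degree_0 leading_coeff_0_iff zero_neq_numeral)
  have "g = smult k [:coeff g 0 / k, coeff g 1 / k, 1:]"
  proof (rule poly_eqI)
    fix n
    show "coeff g n = coeff (smult k [:coeff g 0 / k, coeff g 1 / k, 1:]) n"
    proof (cases "n \<le> 2")
      case True
      then have "n = 0 \<or> n = 1 \<or> n = 2" by auto
      then show ?thesis using k0 unfolding k_def by (auto simp: eval_nat_numeral)
    next
      case False
      then have "coeff g n = 0" using assms by (simp add: coeff_eq_0)
      moreover have "degree (smult k [:coeff g 0 / k, coeff g 1 / k, 1:]) < n"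
        using False k0 by simp
      ultimately show ?thesis by (simp add: coeff_eq_0)
    qed
  qed
  then show thesis using that k0 by blast
qed

lemma no_three_quadratics:
  fixes A B :: rat
  assumes "monom 1 6 + monom A 1 + [:B:] = g * h * k" "degree g = 2" "degree h = 2" "degree k = 2"
  shows "A = 0"
proof -
  obtain l1 a b where g: "l1 \<noteq> 0" "g = smult l1 [:b, a, 1:]" using degree_2_monic[OF assms(2)] .
  obtain l2 c d where h: "l2 \<noteq> 0" "h = smult l2 [:d, c, 1:]" using degree_2_monic[OF assms(3)] .
  obtain l3 e f where k: "l3 \<noteq> 0" "k = smult l3 [:f, e, 1:]" using degree_2_monic[OF assms(4)] .
  define l where "l = l1 * l2 * l3"
  define p where "p = [:b, a, 1:] * [:d, c, 1:] * [:f, e, 1:]"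
  have l0: "l \<noteq> 0" unfolding l_def using g h k by simp
  have "smult l1 x * smult l2 y * smult l3 z = smult l (x * y * z)" for x y z :: "rat poly"
    unfolding l_def by (simp add: mult_ac)
  then have "monom 1 6 + monom A 1 + [:B:] = smult l p"
    unfolding assms(1) g(2) h(2) k(2) p_def by blast
  then have co: "coeff (monom 1 6 + monom A 1 + [:B:]) n = l * coeff p n" for n by simp
  have p: "p = [:b * d * f, a * d * f + c * b * f + e * b * d,
      b * d + b * f + d * f + a * c * f + a * e * d + c * e * b,
      a * c * e + a * (d + f) + c * (b + f) + e * (b + d),
      b + d + f + a * c + a * e + c * e, a + c + e, 1:]"
    unfolding p_def by (simp add: algebra_simps)
  have "l * (a + c + e) = 0" "l * (b + d + f + a * c + a * e + c * e) = 0"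
    "l * (a * c * e + a * (d + f) + c * (b + f) + e * (b + d)) = 0"
    "l * (b * d + b * f + d * f + a * c * f + a * e * d + c * e * b) = 0"
    "l * (a * d * f + c * b * f + e * b * d) = A"
    using co[of 5] co[of 4] co[of 3] co[of 2] co[of 1] unfolding p
    by (simp_all add: coeff_pCons eval_nat_numeral)
  then show ?thesis using l0 quadratic_factors[of a c e b d f] by simp
qed

theorem theorem4p2:
  shows "\<not> (\<exists>A B :: rat. A * B \<noteq> 0 \<and>
           (has_reducibility_type (monom 1 6 + monom A 1 + [:B:]) [1, 1, 2, 2] \<or>
            has_reducibility_type (monom 1 6 + monom A 1 + [:B:]) [2, 2, 2]))"
proof
  assume "\<exists>A B :: rat. A * B \<noteq> 0 \<and>
           (has_reducibility_type (monom 1 6 + monom A 1 + [:B:]) [1, 1, 2, 2] \<or>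
            has_reducibility_type (monom 1 6 + monom A 1 + [:B:]) [2, 2, 2])"
  then obtain A B :: rat where AB: "A * B \<noteq> 0"
    and "has_reducibility_type (monom 1 6 + monom A 1 + [:B:]) [1, 1, 2, 2] \<or>
      has_reducibility_type (monom 1 6 + monom A 1 + [:B:]) [2, 2, 2]"
    by blast
  moreover have "\<exists>gs. F = prod_list gs \<and> map degree gs = ns" if "has_reducibility_type F ns" for F ns
    using that unfolding has_reducibility_type_def by auto
  ultimately obtain gs where gs: "monom 1 6 + monom A 1 + [:B:] = prod_list gs"
    and deg: "map degree gs = [1, 1, 2, 2] \<or> map degree gs = [2, 2, 2]"
    by metis
  from deg have "A = 0"
  proof
    assume "map degree gs = [1, 1, 2, 2]"
    then obtain g1 g2 g3 g4 where g: "gs = [g1, g2, g3, g4]"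
      "degree g1 = 1" "degree g2 = 1" "degree g3 = 2" "degree g4 = 2"
      by (auto simp: map_eq_Cons_conv)
    \<comment> \<open>The two linear factors are merged into one quadratic.\<close>
    have "degree (g1 * g2) = 2" using g by (subst degree_mult_eq) auto
    then show ?thesis using no_three_quadratics[of A B "g1 * g2" g3 g4] gs g by (simp add: mult.assoc)
  next
    assume "map degree gs = [2, 2, 2]"
    then obtain g1 g2 g3 where g: "gs = [g1, g2, g3]" "degree g1 = 2" "degree g2 = 2" "degree g3 = 2"
      by (auto simp: map_eq_Cons_conv)
    then show ?thesis using no_three_quadratics[of A B g1 g2 g3] gs by (simp add: mult.assoc)
  qed
  then show False using AB by simp
qed

end
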